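(* Let $g:[0,+\infty)\to[0,+\infty)$ be a continuous function for which there exist $a_1,a_2>0$ and $q\in[1,2^* )$ such that $$g(t)\leq a_1+a_2t^{q-1}\quad\text{for all } t\geq0.$$ Let $r\in(0,1)$ and let $k:[0,+\infty)\to\mathbb{R}$ be the function defined by $$k(t):=\frac{t^{2-r}-c_{2^*_s}^{2^*}\,t^{2^*-r}}{c_{2^*_s}^{r}|\Omega|^{\frac{2^*-r}{2^*}}+a_1c_{2^*_s}|\Omega|^{\frac{2^*-1}{2^*}}t^{1-r}+a_2c_{2^*_s}^{q}|\Omega|^{\frac{2^*-q}{2^*}}t^{q-r}}\quad\text{for all } t\geq0.$$ Then there exists a nonempty open interval $\Lambda\subseteq\left(0,\max_{[0,+\infty)}k\right)$ such that, for every $\lambda\in\Lambda$, the problem $$\begin{cases}(-\Delta)^su=u^{2^*-1}+\lambda\left(u^{r-1}+g(u)\right)&\text{in }\Omega\\ u>0&\text{in }\Omega\\ u=0&\text{in }\mathbb{R}^n\setminus\Omega\end{cases}$$ admits a weak solution in $X_{0,s}$.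
   Context: Standing assumptions: $s\in(0,1)$, $n$ is a positive integer with $n>2s$, $\Omega\subset\mathbb{R}^n$ is (nonempty) open, bounded, with Lipschitz boundary, $|\Omega|$ is its Lebesgue measure, and $2^*:=\frac{2n}{n-2s}$. The fractional Laplacian is $(-\Delta)^su(x):=-\int_{\mathbb{R}^n}\frac{u(x+y)+u(x-y)-2u(x)}{|y|^{n+2s}}\,dy$ (no further normalization constant). $X_{0,s}:=\{u\in H^s(\mathbb{R}^n): u=0\text{ a.e. in }\mathbb{R}^n\setminus\Omega\}$, where $H^s(\mathbb{R}^n)$ is the usual fractional Sobolev space (real-valued functions), with norm $$\|u\|_{X_{0,s}}:=\left(\int_{\mathbb{R}^{2n}}\frac{|u(x)-u(y)|^2}{|x-y|^{n+2s}}\,dx\,dy\right)^{1/2}$$ and $$c_{2^*_s}:=\sup_{u\in X_{0,s}\setminus\{0\}}\frac{\|u\|_{L^{2^*}(\mathbb{R}^n)}}{\|u\|_{X_{0,s}}},$$ which is finite by the continuous embedding $X_{0,s}\hookrightarrow L^{2^*}(\mathbb{R}^n)$. A weak solution of the problem is a function $u\in X_{0,s}$ such that: $u>0$ a.e. in $\Omega$; $u^{r-1}v\in L^1(\Omega)$ for every $v\in X_{0,s}$; and for every $v\in X_{0,s}$ $$\int_{\mathbb{R}^{2n}}\frac{(u(x)-u(y))(v(x)-v(y))}{|x-y|^{n+2s}}\,dx\,dy=\int_\Omega u^{2^*-1}v\,dx+\lambda\int_\Omega\left(u^{r-1}+g(u)\right)v\,dx.$$ *)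

theory Defs
  imports "HOL-Analysis.Analysis"
begin

(* Near each boundary point p, after a rotation taking the last coordinate axis to the unit
   vector e, the set is the strict epigraph of a Lipschitz function gamma of the remaining
   coordinates, i.e. of the projection of y to the hyperplane orthogonal to e. *)
definition lipschitz_boundary :: "(real ^ 'n) set \<Rightarrow> bool" where
  "lipschitz_boundary \<Omega> \<longleftrightarrow>
     (\<forall>p \<in> frontier \<Omega>. \<exists>\<rho> e \<gamma> L. \<rho> > 0 \<and> norm e = 1 \<and>
        L-lipschitz_on {z. z \<bullet> e = 0} (\<gamma> :: real ^ 'n \<Rightarrow> real) \<and>
        \<Omega> \<inter> ball p \<rho> = {y \<in> ball p \<rho>. \<gamma> (y - (y \<bullet> e) *\<^sub>R e) < y \<bullet> e})"

definition crit_exp :: "nat \<Rightarrow> real \<Rightarrow> real" where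
  "crit_exp n s = 2 * real n / (real n - 2 * s)"

(* The diagonal, where HOL's division by zero gives the value 0, is a null set. *)
definition gagliardo_integrand ::
    "real \<Rightarrow> (real ^ 'n \<Rightarrow> real) \<Rightarrow> (real ^ 'n \<Rightarrow> real) \<Rightarrow> (real ^ 'n) \<times> (real ^ 'n) \<Rightarrow> real" where
  "gagliardo_integrand s u v = (\<lambda>(x, y).
     (u x - u y) * (v x - v y) / norm (x - y) powr (real CARD('n) + 2 * s))"

definition gagliardo_form ::
    "real \<Rightarrow> (real ^ 'n \<Rightarrow> real) \<Rightarrow> (real ^ 'n \<Rightarrow> real) \<Rightarrow> real" where
  "gagliardo_form s u v = (LINT z|lebesgue. gagliardo_integrand s u v z)"

(* Elements are functions rather than classes modulo a.e. equality; every notion below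
   is invariant under changes on null sets. *)
definition frac_sobolev :: "real \<Rightarrow> (real ^ 'n \<Rightarrow> real) set" where
  "frac_sobolev s = {u. u \<in> borel_measurable lebesgue \<and>
     integrable lebesgue (\<lambda>x. (u x)\<^sup>2) \<and>
     integrable lebesgue (gagliardo_integrand s u u)}"

definition X0 :: "real \<Rightarrow> (real ^ 'n) set \<Rightarrow> (real ^ 'n \<Rightarrow> real) set" where
  "X0 s \<Omega> = {u \<in> frac_sobolev s. AE x in lebesgue. x \<notin> \<Omega> \<longrightarrow> u x = 0}"

definition X0_norm :: "real \<Rightarrow> (real ^ 'n \<Rightarrow> real) \<Rightarrow> real" where
  "X0_norm s u = sqrt (gagliardo_form s u u)"

definition Lp_norm :: "real \<Rightarrow> (real ^ 'n \<Rightarrow> real) \<Rightarrow> real" where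
  "Lp_norm p u = (LINT x|lebesgue. \<bar>u x\<bar> powr p) powr (1 / p)"

(* For 0 < s < 1, 2 * s < n and nonempty bounded open \<Omega>, the embedding of X0 into L^p,
   p = crit_exp n s, makes all the integrals finite and the set of quotients bounded above. *)
definition sobolev_const :: "real \<Rightarrow> (real ^ 'n) set \<Rightarrow> real" where
  "sobolev_const s \<Omega> =
     (SUP u \<in> {u \<in> X0 s \<Omega>. \<not> (AE x in lebesgue. u x = 0)}.
        Lp_norm (crit_exp CARD('n) s) u / X0_norm s u)"

definition k_fun ::
    "real \<Rightarrow> (real ^ 'n) set \<Rightarrow> real \<Rightarrow> real \<Rightarrow> real \<Rightarrow> real \<Rightarrow> real \<Rightarrow> real" where
  "k_fun s \<Omega> r q a1 a2 t =
     (let p = crit_exp CARD('n) s; c = sobolev_const s \<Omega>; m = measure lebesgue \<Omega> in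
        (t powr (2 - r) - c powr p * t powr (p - r)) /
        (c powr r * m powr ((p - r) / p)
          + a1 * c * m powr ((p - 1) / p) * t powr (1 - r)
          + a2 * c powr q * m powr ((p - q) / p) * t powr (q - r)))"

definition weak_solution ::
    "real \<Rightarrow> (real ^ 'n) set \<Rightarrow> real \<Rightarrow> (real \<Rightarrow> real) \<Rightarrow> real \<Rightarrow> (real ^ 'n \<Rightarrow> real) \<Rightarrow> bool" where
  "weak_solution s \<Omega> r g l u \<longleftrightarrow>
     u \<in> X0 s \<Omega> \<and>
     (AE x in lebesgue. x \<in> \<Omega> \<longrightarrow> u x > 0) \<and>
     (\<forall>v \<in> X0 s \<Omega>. set_integrable lebesgue \<Omega> (\<lambda>x. u x powr (r - 1) * v x)) \<and>
     (\<forall>v \<in> X0 s \<Omega>. gagliardo_form s u v =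
        (LINT x:\<Omega>|lebesgue. u x powr (crit_exp CARD('n) s - 1) * v x)
        + l * (LINT x:\<Omega>|lebesgue. (u x powr (r - 1) + g (u x)) * v x))"

end

theory Submission imports Defs "HOL-Complex_Analysis.Great_Picard" begin

text \<open>
  Since \<Lambda> may be any interval inside \<open>(0, max k)\<close>, it suffices to know that \<open>k\<close> attains a
  positive maximum and that the problem is solvable for every small positive parameter.

  For the maximum, \<open>k\<close> is continuous, positive near \<open>0\<close> and nonpositive far out as soon as the
  embedding constant is positive and finite (\<open>arg_max_exists\<close>, \<open>sobolev_const_pos\<close>). Finiteness is
  the critical fractional Sobolev inequality. Let \<open>N\<close> be the integral of \<open>\<bar>u\<bar>\<^sup>p\<close>, with
  \<open>p\<close> the critical exponent. By Markov's inequality, \<open>\<bar>u\<bar>\<close> is at most half of \<open>\<bar>u x\<bar>\<close> on half of the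
  ball around \<open>x\<close> whose volume is a suitable multiple of \<open>N / \<bar>u x\<bar>\<^sup>p\<close>. On that half
  the difference quotients at \<open>x\<close> are large, which bounds \<open>\<bar>u x\<bar>\<^sup>p\<close> by a power of \<open>N\<close> times
  the energy density at \<open>x\<close> (\<open>pointwise_sobolev_estimate\<close>); integration over \<open>x\<close> gives the inequality.

  For a small parameter, a small constant \<open>M\<close> acts as an upper barrier. A function that vanishes
  outside the bounded set \<Omega> pays for every excess over \<open>M\<close>, through its interaction with a ball
  outside \<Omega>, an energy of at least a fixed multiple of \<open>M\<close> times the integral of the excess
  (\<open>energy_clamp_gain\<close>). As \<open>p > 2\<close>, the barrier \<open>M\<close> and then the parameter can be chosen such that
  the right-hand side at \<open>M\<close> stays below this gain. Hence, if the nonlinearity is held constant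
  above \<open>M\<close> apart from its decreasing singular part, truncation to \<open>[0, M]\<close> lowers the energy functional \<open>J\<close>, and a minimiser among functions with
  values in \<open>[0, M]\<close> is a minimiser among all functions (\<open>J_clamp_le\<close>). It exists by the direct method:
  a minimising sequence has bounded energy, hence a subsequence that converges almost everywhere
  (\<open>bounded_energy_subsequence\<close>), the energy is lower semicontinuous by Fatou's lemma and the
  remaining term converges by dominated convergence. This covers the critical power as well,
  since all competitors are bounded by \<open>M\<close>.

  The term \<open>u\<^bsup>r-1\<^esup>\<close> makes \<open>J\<close> non-differentiable, so the minimiser \<open>u\<close> is tested by hand. Its
  primitive has infinite slope at \<open>0\<close>, so adding a positive multiple of a function positive
  in \<Omega> would lower \<open>J\<close> if \<open>u\<close> vanished on a set of positive measure (\<open>u_positive\<close>). For a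
  nonnegative test function \<open>v\<close>, upward variations and Fatou's lemma give one inequality, together with
  the integrability of the singular term (\<open>test_lower\<close>). Downward variations are admissible only along
  functions dominated by a multiple of \<open>u\<close>; splitting \<open>v\<close> into \<open>min v (K u)\<close> and the positive part of
  \<open>v - K u\<close>, the second part contributes at most \<open>energy s v v / (4 K)\<close>, which vanishes
  as \<open>K\<close> grows (\<open>test_upper\<close>).
\<close>

section \<open>The energy space and its bilinear form\<close>

lemma gagliardo_integrand_measurable [measurable]:
  fixes u v :: "real ^ 'n \<Rightarrow> real"
  assumes [measurable]: "u \<in> borel_measurable borel" "v \<in> borel_measurable borel"
  shows "gagliardo_integrand s u v \<in> borel_measurable borel"
proof -
  have "(\<lambda>z. (u (fst z) - u (snd z)) * (v (fst z) - v (snd z))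
          / norm (fst z - snd z) powr (real CARD('n) + 2 * s))
        \<in> borel_measurable (borel \<Otimes>\<^sub>M borel)"
    by measurable
  then show ?thesis
    by (simp add: gagliardo_integrand_def borel_prod case_prod_beta')
qed

lemma gagliardo_integrand_eq:
  fixes u v :: "real ^ 'n \<Rightarrow> real"
  shows "gagliardo_integrand s u v (x, y)
       = (u x - u y) * (v x - v y) / norm (x - y) powr (real CARD('n) + 2 * s)"
  by (simp add: gagliardo_integrand_def)

lemma gagliardo_integrand_nonneg: "gagliardo_integrand s u u z \<ge> 0"
  by (cases z) (simp add: gagliardo_integrand_eq)

definition energy :: "real \<Rightarrow> (real ^ 'n \<Rightarrow> real) \<Rightarrow> (real ^ 'n \<Rightarrow> real) \<Rightarrow> real" where
  "energy s u v = (LINT z|lborel. gagliardo_integrand s u v z)"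

text \<open>
  The functions are Borel and vanish at every point outside \<Omega>, so that the constructions below
  need no exceptional null sets; \<open>X0_representative\<close> gives the link to the space of the
  problem.
\<close>
definition energy_space :: "real \<Rightarrow> (real ^ 'n) set \<Rightarrow> (real ^ 'n \<Rightarrow> real) set" where
  "energy_space s \<Omega> = {u \<in> borel_measurable borel. (\<forall>x. x \<notin> \<Omega> \<longrightarrow> u x = 0) \<and>
     integrable lborel (\<lambda>x. (u x)\<^sup>2) \<and> integrable lborel (gagliardo_integrand s u u)}"

lemma energy_spaceD:
  assumes "u \<in> energy_space s \<Omega>"
  shows "u \<in> borel_measurable borel" "\<And>x. x \<notin> \<Omega> \<Longrightarrow> u x = 0"
    "integrable lborel (\<lambda>x. (u x)\<^sup>2)" "integrable lborel (gagliardo_integrand s u u)"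
  using assms by (auto simp: energy_space_def)

lemma integrable_gagliardo_integrand:
  fixes u v :: "real ^ 'n \<Rightarrow> real"
  assumes "u \<in> energy_space s \<Omega>" "v \<in> energy_space s \<Omega>'"
  shows "integrable lborel (gagliardo_integrand s u v)"
proof (rule Bochner_Integration.integrable_bound)
  note [measurable] = energy_spaceD(1)[OF assms(1)] energy_spaceD(1)[OF assms(2)]
  show "integrable lborel (\<lambda>z. gagliardo_integrand s u u z + gagliardo_integrand s v v z)"
    using energy_spaceD(4)[OF assms(1)] energy_spaceD(4)[OF assms(2)] by simp
  show "gagliardo_integrand s u v \<in> borel_measurable lborel"
    by simp
  have "\<bar>a * b\<bar> \<le> a * a + b * b" for a b :: real
  proof -
    have "0 \<le> (\<bar>a\<bar> - \<bar>b\<bar>)\<^sup>2" by simp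
    then have "2 * (\<bar>a\<bar> * \<bar>b\<bar>) \<le> a * a + b * b"
      by (simp add: power2_eq_square algebra_simps)
    moreover have "0 \<le> \<bar>a\<bar> * \<bar>b\<bar>" by simp
    ultimately show ?thesis by (simp only: abs_mult)
  qed
  from divide_right_mono[OF this]
  show "AE z in lborel. norm (gagliardo_integrand s u v z)
      \<le> norm (gagliardo_integrand s u u z + gagliardo_integrand s v v z)"
    by (intro always_eventually)
      (auto simp: gagliardo_integrand_eq add_divide_distrib gagliardo_integrand_nonneg)
qed

text \<open>
  All closure properties of the space come from this one criterion: pointwise operations that
  are jointly Lipschitz and fix \<open>0\<close> (sums, multiples, minima, maxima, truncations) preserve
  finiteness of the energy.
\<close>
lemma energy_space_lipschitz_op:
  fixes u v w :: "real ^ 'n \<Rightarrow> real"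
  assumes u: "u \<in> energy_space s \<Omega>" and v: "v \<in> energy_space s \<Omega>"
    and [measurable]: "w \<in> borel_measurable borel" and "0 \<le> C"
    and w0: "\<And>x. \<bar>w x\<bar> \<le> C * (\<bar>u x\<bar> + \<bar>v x\<bar>)"
    and w: "\<And>x y. \<bar>w x - w y\<bar> \<le> C * (\<bar>u x - u y\<bar> + \<bar>v x - v y\<bar>)"
  shows "w \<in> energy_space s \<Omega>"
proof -
  note [measurable] = energy_spaceD(1)[OF u] energy_spaceD(1)[OF v]
  have sq: "c\<^sup>2 \<le> 2 * C\<^sup>2 * (a\<^sup>2 + b\<^sup>2)" if "\<bar>c\<bar> \<le> C * (\<bar>a\<bar> + \<bar>b\<bar>)" for a b c :: real
  proof -
    have "c\<^sup>2 \<le> (C * (\<bar>a\<bar> + \<bar>b\<bar>))\<^sup>2"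
      by (rule abs_le_square_iff[THEN iffD1]) (use that \<open>0 \<le> C\<close> in auto)
    also have "\<dots> = C\<^sup>2 * (\<bar>a\<bar> + \<bar>b\<bar>)\<^sup>2"
      by (simp add: power_mult_distrib)
    also have "\<dots> \<le> C\<^sup>2 * (2 * (a\<^sup>2 + b\<^sup>2))"
      using sum_squares_bound[of "\<bar>a\<bar>" "\<bar>b\<bar>"] by (intro mult_left_mono) (auto simp: power2_sum)
    finally show ?thesis by (simp add: algebra_simps)
  qed
  have "integrable lborel (\<lambda>x. (w x)\<^sup>2)"
  proof (rule Bochner_Integration.integrable_bound)
    show "integrable lborel (\<lambda>x. 2 * C\<^sup>2 * ((u x)\<^sup>2 + (v x)\<^sup>2))"
      using energy_spaceD(3)[OF u] energy_spaceD(3)[OF v] by simp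
    show "AE x in lborel. norm ((w x)\<^sup>2) \<le> norm (2 * C\<^sup>2 * ((u x)\<^sup>2 + (v x)\<^sup>2))"
      using sq[OF w0] by (auto intro!: always_eventually)
  qed simp
  moreover have "integrable lborel (gagliardo_integrand s w w)"
  proof (rule Bochner_Integration.integrable_bound)
    show "integrable lborel (\<lambda>z. 2 * C\<^sup>2 * (gagliardo_integrand s u u z + gagliardo_integrand s v v z))"
      using energy_spaceD(4)[OF u] energy_spaceD(4)[OF v] by simp
    show "AE z in lborel. norm (gagliardo_integrand s w w z)
      \<le> norm (2 * C\<^sup>2 * (gagliardo_integrand s u u z + gagliardo_integrand s v v z))"
    proof (intro always_eventually allI)
      fix z :: "(real ^ 'n) \<times> (real ^ 'n)"
      obtain x y where z: "z = (x, y)" by (cases z)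
      show "norm (gagliardo_integrand s w w z)
        \<le> norm (2 * C\<^sup>2 * (gagliardo_integrand s u u z + gagliardo_integrand s v v z))"
        using divide_right_mono[OF sq[OF w], of "norm (x - y) powr (real CARD('n) + 2 * s)" x y]
        by (simp add: z gagliardo_integrand_eq power2_eq_square add_divide_distrib[symmetric])
    qed
  qed simp
  moreover have "w x = 0" if "x \<notin> \<Omega>" for x
    using w0[of x] energy_spaceD(2)[OF u that] energy_spaceD(2)[OF v that] by simp
  ultimately show ?thesis
    by (simp add: energy_space_def)
qed

lemma energy_space_zero: "(\<lambda>_. 0) \<in> energy_space s (\<Omega> :: (real ^ 'n) set)"
proof -
  have "gagliardo_integrand s (\<lambda>_ :: real ^ 'n. 0) (\<lambda>_. 0) = (\<lambda>_. 0)"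
    by (auto simp: gagliardo_integrand_def)
  then show ?thesis by (simp add: energy_space_def)
qed

lemma energy_space_add_scaled:
  assumes u: "u \<in> energy_space s \<Omega>" and v: "v \<in> energy_space s \<Omega>"
  shows "(\<lambda>x. u x + c * v x) \<in> energy_space s \<Omega>"
proof (rule energy_space_lipschitz_op[OF u v])
  note [measurable] = energy_spaceD(1)[OF u] energy_spaceD(1)[OF v]
  show "(\<lambda>x. u x + c * v x) \<in> borel_measurable borel" by measurable
  have *: "\<bar>a + c * b\<bar> \<le> (1 + \<bar>c\<bar>) * (\<bar>a\<bar> + \<bar>b\<bar>)" for a b :: real
  proof -
    have "\<bar>a + c * b\<bar> \<le> \<bar>a\<bar> + \<bar>c\<bar> * \<bar>b\<bar>"
      by (metis abs_mult abs_triangle_ineq)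
    also have "\<dots> \<le> (1 + \<bar>c\<bar>) * (\<bar>a\<bar> + \<bar>b\<bar>)"
      by (simp add: algebra_simps)
    finally show ?thesis .
  qed
  show "\<bar>u x + c * v x\<bar> \<le> (1 + \<bar>c\<bar>) * (\<bar>u x\<bar> + \<bar>v x\<bar>)" for x by (rule *)
  show "\<bar>u x + c * v x - (u y + c * v y)\<bar> \<le> (1 + \<bar>c\<bar>) * (\<bar>u x - u y\<bar> + \<bar>v x - v y\<bar>)" for x y
    using *[of "u x - u y" "v x - v y"] by (simp add: algebra_simps)
qed simp

lemma energy_space_min_max:
  assumes u: "u \<in> energy_space s \<Omega>" and v: "v \<in> energy_space s \<Omega>"
  shows "(\<lambda>x. min (u x) (v x)) \<in> energy_space s \<Omega>"
    and "(\<lambda>x. max (u x) (v x)) \<in> energy_space s \<Omega>"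
proof -
  note [measurable] = energy_spaceD(1)[OF u] energy_spaceD(1)[OF v]
  show "(\<lambda>x. min (u x) (v x)) \<in> energy_space s \<Omega>"
    by (rule energy_space_lipschitz_op[OF u v, where C = 1]) auto
  show "(\<lambda>x. max (u x) (v x)) \<in> energy_space s \<Omega>"
    by (rule energy_space_lipschitz_op[OF u v, where C = 1]) auto
qed

lemma energy_space_clamp:
  assumes u: "u \<in> energy_space s \<Omega>" and "0 \<le> M"
  shows "(\<lambda>x. min (max (u x) 0) M) \<in> energy_space s \<Omega>"
proof (rule energy_space_lipschitz_op[OF u energy_space_zero, where C = 1])
  note [measurable] = energy_spaceD(1)[OF u]
  show "(\<lambda>x. min (max (u x) 0) M) \<in> borel_measurable borel" by measurable
qed (use \<open>0 \<le> M\<close> in auto)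

lemma energy_self_nonneg: "energy s u u \<ge> 0"
  unfolding energy_def by (rule Bochner_Integration.integral_nonneg) (rule gagliardo_integrand_nonneg)

lemma energy_add_scaled:
  assumes u: "u \<in> energy_space s \<Omega>" and v: "v \<in> energy_space s \<Omega>" and w: "w \<in> energy_space s \<Omega>"
  shows "energy s u (\<lambda>x. v x + c * w x) = energy s u v + c * energy s u w"
proof -
  have "gagliardo_integrand s u (\<lambda>x. v x + c * w x) z
      = gagliardo_integrand s u v z + c * gagliardo_integrand s u w z" for z
    by (cases z) (simp add: gagliardo_integrand_eq add_divide_distrib[symmetric] algebra_simps)
  then show ?thesis
    using integrable_gagliardo_integrand[OF u v] integrable_gagliardo_integrand[OF u w]
    by (simp add: energy_def)
qed

lemma energy_commute: "energy s u v = energy s v u"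
proof -
  have "gagliardo_integrand s u v = gagliardo_integrand s v u"
    by (auto simp: gagliardo_integrand_def mult.commute)
  then show ?thesis by (simp add: energy_def)
qed

lemma energy_expand:
  assumes u: "u \<in> energy_space s \<Omega>" and v: "v \<in> energy_space s \<Omega>"
  shows "energy s (\<lambda>x. u x + c * v x) (\<lambda>x. u x + c * v x)
    = energy s u u + 2 * c * energy s u v + c\<^sup>2 * energy s v v"
proof -
  let ?w = "\<lambda>x. u x + c * v x"
  have "energy s ?w ?w = energy s ?w u + c * energy s ?w v"
    using energy_add_scaled[OF energy_space_add_scaled[OF u v] u v] .
  moreover have "energy s ?w u = energy s u u + c * energy s u v"
    using energy_add_scaled[OF u u v] energy_commute by metis
  moreover have "energy s ?w v = energy s u v + c * energy s v v"
    using energy_add_scaled[OF v u v] energy_commute by metis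
  ultimately show ?thesis by (simp add: algebra_simps power2_eq_square)
qed

section \<open>Borel representatives of Sobolev functions\<close>

text \<open>
  Lebesgue measure is complete, so changing a function on a null set does not destroy
  measurability, even when the exceptional set itself is not Borel.
\<close>
lemma borel_measurable_completion_AE:
  fixes f g :: "'a \<Rightarrow> real"
  assumes f: "f \<in> borel_measurable M" and eq: "AE x in M. f x = g x"
  shows "g \<in> borel_measurable (completion M)"
proof (rule measurableI)
  fix A :: "real set" assume A: "A \<in> sets borel"
  define D where "D x \<longleftrightarrow> (f x \<in> A) \<noteq> (g x \<in> A)" for x
  define D' where "D' x \<longleftrightarrow> D x \<and> g x \<in> A" for x
  have [measurable]: "Measurable.pred (completion M) (\<lambda>x. f x \<in> A)"
    using measurable_completion[OF f] A by simp
  have [measurable]: "Measurable.pred (completion M) D" "Measurable.pred (completion M) D'"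
    by (rule sets_completion_AE, use eq in eventually_elim, simp add: D_def D'_def)+
  have "Measurable.pred (completion M) (\<lambda>x. (f x \<in> A \<and> \<not> D x) \<or> D' x)"
    by measurable
  also have "(\<lambda>x. (f x \<in> A \<and> \<not> D x) \<or> D' x) = (\<lambda>x. g x \<in> A)"
    by (auto simp: D_def D'_def)
  finally show "g -` A \<inter> space (completion M) \<in> sets (completion M)"
    by (simp add: pred_def vimage_def Int_def conj_commute)
qed simp

lemma AE_lborel_pair:
  fixes P :: "'a::euclidean_space \<Rightarrow> bool"
  assumes "AE x in lborel. P x"
  shows "AE z in (lborel :: ('a \<times> 'a) measure). P (fst z) \<and> P (snd z)"
proof -
  obtain N where N: "{x \<in> space lborel. \<not> P x} \<subseteq> N" "emeasure lborel N = 0" "N \<in> sets lborel"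
    by (rule AE_E[OF assms])
  have "N \<times> UNIV \<in> null_sets (lborel \<Otimes>\<^sub>M lborel)" "UNIV \<times> N \<in> null_sets (lborel \<Otimes>\<^sub>M lborel)"
    using N(2,3) by (simp_all add: null_sets_def lborel.emeasure_pair_measure_Times pair_measureI)
  then have "N \<times> UNIV \<union> UNIV \<times> N \<in> null_sets (lborel :: ('a \<times> 'a) measure)"
    by (auto simp: lborel_prod)
  then show ?thesis
    by (rule AE_I') (use N(1) in auto)
qed

lemma energy_space_gagliardo_form:
  assumes "u \<in> borel_measurable borel" "v \<in> borel_measurable borel"
  shows "gagliardo_form s u v = energy s u v"
  using gagliardo_integrand_measurable[OF assms]
  by (simp add: gagliardo_form_def energy_def integral_completion)

lemma energy_space_subset_X0:
  assumes u: "u \<in> energy_space s \<Omega>"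
  shows "u \<in> X0 s \<Omega>"
proof -
  note [measurable] = energy_spaceD(1)[OF u]
  have "integrable lebesgue (\<lambda>x. (u x)\<^sup>2)"
    using energy_spaceD(3)[OF u] by (subst integrable_completion) auto
  moreover have "integrable lebesgue (gagliardo_integrand s u u)"
    using energy_spaceD(4)[OF u] by (subst integrable_completion) auto
  moreover have "u \<in> borel_measurable lebesgue"
    by (rule measurable_completion) simp
  ultimately show ?thesis
    using energy_spaceD(2)[OF u] by (auto simp: X0_def frac_sobolev_def)
qed

text \<open>
  Fubini arguments need Borel functions. A change of \<open>v\<close> on a null set \<open>N\<close> affects the
  Gagliardo integrand only on the null set \<open>N \<times> UNIV \<union> UNIV \<times> N\<close>, so every quantity of the
  problem can be computed from \<open>w\<close>.
\<close>
lemma X0_representative: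
  fixes v :: "real ^ 'n \<Rightarrow> real"
  assumes v: "v \<in> X0 s \<Omega>" and [measurable]: "\<Omega> \<in> sets borel"
  obtains w where "w \<in> energy_space s \<Omega>" "AE x in lborel. v x = w x"
    "gagliardo_form s v v = energy s w w"
    "\<And>u. u \<in> borel_measurable borel \<Longrightarrow> gagliardo_form s u v = energy s u w"
proof -
  have v_meas: "v \<in> borel_measurable lebesgue"
    and v_sq: "integrable lebesgue (\<lambda>x. (v x)\<^sup>2)"
    and v_gag: "integrable lebesgue (gagliardo_integrand s v v)"
    and v_0: "AE x in lborel. x \<notin> \<Omega> \<longrightarrow> v x = 0"
    using v by (auto simp: X0_def frac_sobolev_def AE_completion_iff)
  obtain w0 where w0: "w0 \<in> borel_measurable lborel" "AE x in lborel. v x = w0 x"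
    using completion_ex_borel_measurable_real[OF v_meas] by auto
  define w where "w x = indicator \<Omega> x * w0 x" for x
  have [measurable]: "w \<in> borel_measurable borel"
    using w0(1) unfolding w_def by simp
  have vw: "AE x in lborel. v x = w x"
    using w0(2) v_0 by eventually_elim (auto simp: w_def indicator_def)
  note vw2 = AE_lborel_pair[OF vw]
  have gag: "gagliardo_form s u' v = energy s u w"
    if [measurable]: "u \<in> borel_measurable borel"
      and eq: "AE z in lborel. gagliardo_integrand s u' v z = gagliardo_integrand s u w z" for u u'
  proof -
    have m: "gagliardo_integrand s u' v \<in> borel_measurable lebesgue"
      by (rule borel_measurable_completion_AE[of "gagliardo_integrand s u w"])
         (use eq in \<open>simp_all add: eq_commute\<close>)
    have "gagliardo_form s u' v = (LINT z|lebesgue. gagliardo_integrand s u w z)"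
      unfolding gagliardo_form_def
      by (rule integral_cong_AE[OF m])
         (use AE_completion[OF eq] in \<open>simp_all add: measurable_completion\<close>)
    then show ?thesis
      by (simp add: energy_def integral_completion)
  qed
  have eqv: "AE z in lborel. gagliardo_integrand s v v z = gagliardo_integrand s w w z"
    using vw2 by eventually_elim (simp add: gagliardo_integrand_def case_prod_beta)
  have "integrable lborel (\<lambda>x. (w x)\<^sup>2)"
  proof -
    have "integrable lebesgue (\<lambda>x. (w x)\<^sup>2)"
    proof (rule integrable_cong_AE_imp[OF v_sq])
      show "AE x in lebesgue. (v x)\<^sup>2 = (w x)\<^sup>2"
        using AE_completion[OF vw] by eventually_elim simp
    qed (simp add: measurable_completion)
    then show ?thesis by (subst (asm) integrable_completion) auto
  qed
  moreover have "integrable lborel (gagliardo_integrand s w w)"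
  proof -
    have "integrable lebesgue (gagliardo_integrand s w w)"
      by (rule integrable_cong_AE_imp[OF v_gag])
         (use AE_completion[OF eqv] in \<open>simp_all add: measurable_completion\<close>)
    then show ?thesis by (subst (asm) integrable_completion) auto
  qed
  ultimately have "w \<in> energy_space s \<Omega>"
    by (auto simp: energy_space_def w_def)
  moreover have "gagliardo_form s v v = energy s w w"
    by (rule gag) (use eqv in simp_all)
  moreover have "gagliardo_form s u v = energy s u w" if "u \<in> borel_measurable borel" for u
    by (rule gag[OF that])
       (use vw2 in eventually_elim, simp add: gagliardo_integrand_def case_prod_beta)
  ultimately show ?thesis
    using vw that by blast
qed

section \<open>Lipschitz functions have finite energy\<close>

lemma ex_dyadic_scale:
  fixes t :: real
  assumes "1 \<le> t"
  obtains k :: nat where "2 ^ k \<le> t" "t < 2 ^ Suc k"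
proof -
  obtain m :: nat where m: "t < 2 ^ m" using real_arch_pow[of 2 t] by auto
  define k where "k = (LEAST m. t < (2 :: real) ^ m)"
  have k: "t < 2 ^ k" unfolding k_def by (rule LeastI[of _ m]) (rule m)
  with assms have "k \<noteq> 0" by (metis not_less power_0)
  then obtain j where j: "k = Suc j" by (cases k) auto
  then have "\<not> t < 2 ^ j" using not_less_Least[of j "\<lambda>m. t < (2 :: real) ^ m"] k_def by auto
  then show ?thesis using that[of j] k j by auto
qed

text \<open>
  On a dyadic shell of radius \<open>2\<^sup>k\<close> the integral is of order \<open>2\<close> to the power
  \<open>(2 - 2 * s) * k\<close> near the origin and \<open>- 2 * s * k\<close> far away. As \<open>0 < s < 1\<close>, both ranges
  give convergent geometric series; these are the ratios \<open>q1\<close> and \<open>q2\<close>.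
\<close>
lemma nn_integral_kernel_finite:
  fixes s :: real
  assumes "0 < s" "s < 1"
  shows "(\<integral>\<^sup>+ z. ennreal (min 1 ((norm z)\<^sup>2) / norm z powr (real CARD('n) + 2 * s))
            \<partial>(lborel :: (real ^ 'n) measure)) < \<infinity>"
proof -
  define n where "n = CARD('n)"
  define d where "d = real n + 2 * s"
  define \<theta> where "\<theta> = (1 / 2 :: real) powr d"
  define \<omega> where "\<omega> = unit_ball_vol (real n)"
  define T where "T z = min 1 ((norm z)\<^sup>2) / norm z powr d" for z :: "real ^ 'n"
  define c1 where "c1 k = (1 / 4) ^ k / \<theta> ^ Suc k" for k
  define c2 where "c2 k = \<theta> ^ k" for k
  define f where "f k z = ennreal (c1 k) * indicator (cball 0 ((1 / 2) ^ k)) z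
      + ennreal (c2 k) * indicator (cball 0 (2 ^ Suc k)) z" for k and z :: "real ^ 'n"
  have [measurable]: "cball (0 :: real ^ 'n) \<rho> \<in> sets borel" for \<rho>
    by (rule borel_closed) simp
  have th: "0 < \<theta>" by (simp add: \<theta>_def)
  have d: "0 < d" using assms by (simp add: d_def add_nonneg_pos)
  have half_powr: "((1 / 2) ^ k) powr d = \<theta> ^ k" for k
    by (simp add: \<theta>_def powr_powr mult.commute flip: powr_realpow)
  have le_dyadic: "ennreal (T z) \<le> (\<Sum>k. f k z)" for z :: "real ^ 'n"
  proof (cases "z = 0")
    case True
    then show ?thesis by (simp add: T_def)
  next
    case False
    then have z: "norm z > 0" by simp
    have "\<exists>k. ennreal (T z) \<le> f k z"
    proof (cases "norm z < 1")
      case True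
      then have "1 \<le> 1 / norm z" using z by simp
      then obtain k :: nat where k: "2 ^ k \<le> 1 / norm z" "1 / norm z < 2 ^ Suc k"
        by (rule ex_dyadic_scale)
      have le: "norm z \<le> (1 / 2) ^ k"
        using k(1) z by (simp add: field_simps power_divide)
      have "(1 / 2) ^ Suc k \<le> norm z"
        using k(2) z by (simp add: field_simps power_divide)
      then have 1: "\<theta> ^ Suc k \<le> norm z powr d"
        using powr_mono2[of d "(1 / 2) ^ Suc k" "norm z"] d by (simp only: half_powr) auto
      have 2: "(norm z)\<^sup>2 \<le> (1 / 4) ^ k"
      proof -
        have "((1 / 2) ^ k)\<^sup>2 = (1 / 4 :: real) ^ k"
          by (simp add: power2_eq_square flip: power_mult_distrib)
        with power_mono[OF le, of 2] show ?thesis by simp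
      qed
      have "T z \<le> c1 k"
        unfolding T_def c1_def
        by (rule frac_le) (use 1 2 th z in auto)
      then have "ennreal (T z) \<le> f k z"
        using le by (auto simp: f_def intro!: add_increasing2 ennreal_leI)
      then show ?thesis ..
    next
      case False
      then obtain k :: nat where k: "2 ^ k \<le> norm z" "norm z < 2 ^ Suc k"
        using ex_dyadic_scale[of "norm z"] by auto
      have "(2 ^ k) powr d * \<theta> ^ k = 1"
      proof -
        have "(2 ^ k) powr d * \<theta> ^ k = (2 ^ k * (1 / 2) ^ k) powr d"
          unfolding half_powr[symmetric] by (simp only: powr_mult)
        also have "2 ^ k * (1 / 2) ^ k = (1 :: real)"
          by (simp flip: power_mult_distrib)
        finally show ?thesis by simp
      qed
      then have th': "\<theta> ^ k = 1 / (2 ^ k) powr d"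
        by (simp add: field_simps)
      have "(2 ^ k) powr d \<le> norm z powr d"
        using k(1) d by (intro powr_mono2) auto
      then have "T z \<le> c2 k"
        unfolding T_def c2_def th' by (intro frac_le) auto
      then have "ennreal (T z) \<le> f k z"
        using k(2) by (auto simp: f_def intro!: add_increasing ennreal_leI)
      then show ?thesis ..
    qed
    then obtain k where "ennreal (T z) \<le> f k z" ..
    also have "\<dots> \<le> (\<Sum>k. f k z)"
      using sum_le_suminf[of "\<lambda>k. f k z" "{k}"] by auto
    finally show ?thesis .
  qed
  \<comment> \<open>The measures \<open>\<omega> * \<rho>\<^sup>n\<close> of the dyadic balls turn the coefficients into the two geometric series.\<close>
  have 2: "2 powr real n * ((1 / 2 :: real) powr real n) = 1"
    by (simp flip: powr_mult)
  have th_eq: "\<theta> = (1 / 2) powr real n * (1 / 2) powr (2 * s)"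
    by (simp add: \<theta>_def d_def powr_add)
  have pn: "(2 :: real) ^ n = 2 powr real n" "(1 / 2 :: real) ^ n = (1 / 2) powr real n"
    by (simp_all add: powr_realpow)
  define q1 where "q1 = (1 / 4) * (1 / 2) ^ n / \<theta>"
  define q2 where "q2 = \<theta> * 2 ^ n"
  have q1_eq: "q1 = (1 / 4) / (1 / 2) powr (2 * s)"
    by (simp add: q1_def th_eq pn)
  have "(1 / 2 :: real) powr (2 * s) > (1 / 2) powr 2"
    using assms by (intro powr_less_mono') auto
  then have "1 / 4 < (1 / 2 :: real) powr (2 * s)"
    by (simp add: power2_eq_square)
  then have q1: "0 < q1" "q1 < 1"
    by (simp_all add: q1_eq divide_less_eq)
  have "q2 = (1 / 2) powr (2 * s)"
    using 2 by (simp add: q2_def th_eq pn mult_ac)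
  moreover have "(1 / 2 :: real) powr (2 * s) < (1 / 2) powr 0"
    using assms by (intro powr_less_mono') auto
  ultimately have q2: "0 < q2" "q2 < 1" by auto
  have int_f: "(\<integral>\<^sup>+ z. f k z \<partial>lborel) = ennreal (\<omega> / \<theta> * q1 ^ k + \<omega> * 2 ^ n * q2 ^ k)" for k
  proof -
    have "(\<integral>\<^sup>+ z. f k z \<partial>lborel) = ennreal (c1 k) * emeasure lborel (cball (0 :: real ^ 'n) ((1 / 2) ^ k))
        + ennreal (c2 k) * emeasure lborel (cball (0 :: real ^ 'n) (2 ^ Suc k))"
      unfolding f_def by (subst nn_integral_add) (simp_all add: nn_integral_cmult_indicator)
    also have "\<dots> = ennreal (c1 k) * ennreal (\<omega> * ((1 / 2) ^ k) ^ n) + ennreal (c2 k) * ennreal (\<omega> * (2 ^ Suc k) ^ n)"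
      by (simp add: emeasure_cball \<omega>_def n_def)
    also have "\<dots> = ennreal (c1 k * (\<omega> * ((1 / 2) ^ k) ^ n) + c2 k * (\<omega> * (2 ^ Suc k) ^ n))"
      using th by (simp add: \<omega>_def c1_def c2_def flip: ennreal_mult' ennreal_plus)
    also have "c1 k * (\<omega> * ((1 / 2) ^ k) ^ n) = \<omega> / \<theta> * q1 ^ k"
      by (simp add: c1_def q1_def power_divide power_mult_distrib mult.commute flip: power_mult)
    also have "c2 k * (\<omega> * (2 ^ Suc k) ^ n) = \<omega> * 2 ^ n * q2 ^ k"
      by (simp add: c2_def q2_def power_mult_distrib mult_ac flip: power_mult)
    finally show ?thesis .
  qed
  have sm: "summable (\<lambda>k. \<omega> / \<theta> * q1 ^ k + \<omega> * 2 ^ n * q2 ^ k)"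
    using q1 q2 by (intro summable_add summable_mult summable_geometric) auto
  have "(\<integral>\<^sup>+ z. ennreal (T z) \<partial>lborel) \<le> (\<integral>\<^sup>+ z. (\<Sum>k. f k z) \<partial>lborel)"
    by (intro nn_integral_mono le_dyadic)
  also have "\<dots> = (\<Sum>k. \<integral>\<^sup>+ z. f k z \<partial>lborel)"
    by (rule nn_integral_suminf) (simp add: f_def)
  also have "\<dots> < \<infinity>"
    unfolding int_f using suminf_ennreal_eq[OF _ summable_sums[OF sm]] th q1(1) q2(1)
    by (simp add: \<omega>_def)
  finally show ?thesis by (simp add: T_def d_def n_def)
qed

lemma nn_integral_lborel_shift:
  fixes f :: "'a::euclidean_space \<Rightarrow> ennreal"
  assumes [measurable]: "f \<in> borel_measurable borel"
  shows "(\<integral>\<^sup>+ x. f (x + c) \<partial>lborel) = (\<integral>\<^sup>+ x. f x \<partial>lborel)"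
proof -
  have "(\<integral>\<^sup>+ x. f x \<partial>lborel) = (\<integral>\<^sup>+ x. f x \<partial>distr lborel borel ((+) c))"
    by (simp add: lborel_distr_plus)
  also have "\<dots> = (\<integral>\<^sup>+ x. f (x + c) \<partial>lborel)"
    by (subst nn_integral_distr) (auto simp: add.commute)
  finally show ?thesis ..
qed

lemma nn_integral_pair_lborel:
  fixes f :: "'a::euclidean_space \<times> 'b::euclidean_space \<Rightarrow> ennreal"
  assumes "f \<in> borel_measurable borel"
  shows "(\<integral>\<^sup>+ z. f z \<partial>lborel) = (\<integral>\<^sup>+ x. \<integral>\<^sup>+ y. f (x, y) \<partial>lborel \<partial>lborel)"
    and "(\<integral>\<^sup>+ z. f z \<partial>lborel) = (\<integral>\<^sup>+ y. \<integral>\<^sup>+ x. f (x, y) \<partial>lborel \<partial>lborel)"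
proof -
  have f: "f \<in> borel_measurable (lborel \<Otimes>\<^sub>M lborel)"
    using assms by (simp add: lborel_prod)
  show "(\<integral>\<^sup>+ z. f z \<partial>lborel) = (\<integral>\<^sup>+ x. \<integral>\<^sup>+ y. f (x, y) \<partial>lborel \<partial>lborel)"
    using lborel.nn_integral_fst[OF f] by (simp add: lborel_prod)
  show "(\<integral>\<^sup>+ z. f z \<partial>lborel) = (\<integral>\<^sup>+ y. \<integral>\<^sup>+ x. f (x, y) \<partial>lborel \<partial>lborel)"
    using lborel_pair.nn_integral_snd[of "\<lambda>z. f z"] f by (simp add: lborel_prod)
qed

text \<open>
  Differences of \<open>w\<close> are at most of order \<open>min 1 (norm (x - y))\<close> and vanish when both points
  lie outside \<Omega>, so the energy is bounded by the volume of \<Omega> times the integral of the kernel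
  above.
\<close>
lemma lipschitz_in_energy_space:
  fixes w :: "real ^ 'n \<Rightarrow> real"
  assumes s: "0 < s" "s < 1" and \<Omega>: "\<Omega> \<in> sets borel" "emeasure lborel \<Omega> < \<infinity>"
    and lip: "\<And>x y. \<bar>w x - w y\<bar> \<le> norm (x - y)"
    and bound: "\<And>x. \<bar>w x\<bar> \<le> D" and w0: "\<And>x. x \<notin> \<Omega> \<Longrightarrow> w x = 0"
  shows "w \<in> energy_space s \<Omega>"
proof -
  note \<Omega>(1)[measurable]
  have "1-lipschitz_on UNIV w"
    by (rule lipschitz_onI) (use lip in \<open>auto simp: dist_norm\<close>)
  then have "continuous_on UNIV w" by (rule lipschitz_on_continuous_on)
  then have [measurable]: "w \<in> borel_measurable borel"
    by (rule borel_measurable_continuous_onI)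
  define d where "d = real CARD('n) + 2 * s"
  define T where "T z = min 1 ((norm z)\<^sup>2) / norm z powr d" for z :: "real ^ 'n"
  have [measurable]: "T \<in> borel_measurable borel" unfolding T_def by measurable
  have T_nonneg: "T z \<ge> 0" for z by (simp add: T_def)
  have T_sym: "T (x - y) = T (y - x)" for x y by (simp add: T_def norm_minus_commute)
  have D: "0 \<le> D" using bound[of 0] by simp
  define C where "C = 1 + 4 * D\<^sup>2"
  have pt: "gagliardo_integrand s w w (x, y) \<le> C * (indicator \<Omega> x * T (x - y) + indicator \<Omega> y * T (y - x))" for x y
  proof (cases "x \<in> \<Omega> \<or> y \<in> \<Omega>")
    case True
    have "\<bar>w x - w y\<bar>\<^sup>2 \<le> (norm (x - y))\<^sup>2"
      by (rule power_mono) (use lip in auto)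
    moreover have "\<bar>w x - w y\<bar>\<^sup>2 \<le> (2 * D)\<^sup>2"
      by (rule power_mono) (use bound[of x] bound[of y] in auto)
    moreover have "a \<le> (1 + 4 * e) * min 1 b" if "a \<le> b" "a \<le> 4 * e" "0 \<le> e" "0 \<le> b" for a b e :: real
    proof (cases "1 \<le> b")
      case False
      have "b * 1 \<le> b * (1 + 4 * e)"
        using that by (intro mult_left_mono) auto
      with that False show ?thesis by (simp add: mult.commute)
    qed (use that in auto)
    ultimately have "(w x - w y)\<^sup>2 \<le> C * min 1 ((norm (x - y))\<^sup>2)"
      by (simp add: C_def power_mult_distrib)
    then have "gagliardo_integrand s w w (x, y) \<le> C * T (x - y)"
      unfolding gagliardo_integrand_eq T_def d_def
      using divide_right_mono[of "(w x - w y)\<^sup>2" _ "norm (x - y) powr (real CARD('n) + 2 * s)"]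
      by (simp add: power2_eq_square)
    also have "\<dots> \<le> C * (indicator \<Omega> x * T (x - y) + indicator \<Omega> y * T (y - x))"
      using True D T_nonneg[of "x - y"]
      by (intro mult_left_mono) (auto simp: C_def indicator_def T_sym)
    finally show ?thesis .
  next
    case False
    then show ?thesis by (simp add: gagliardo_integrand_eq w0)
  qed
  define I where "I = (\<integral>\<^sup>+ z. ennreal (T z) \<partial>(lborel :: (real ^ 'n) measure))"
  have I: "I < \<infinity>"
    using nn_integral_kernel_finite[OF s, where 'n = 'n] by (simp add: I_def T_def d_def)
  have slice: "(\<integral>\<^sup>+ y. ennreal (T (x - y)) \<partial>lborel) = I" for x
    using nn_integral_lborel_shift[of "\<lambda>z. ennreal (T z)" "- x"] by (simp add: I_def T_sym[of x])
  have half: "(\<integral>\<^sup>+ x. \<integral>\<^sup>+ y. ennreal (indicator \<Omega> x * T (x - y)) \<partial>lborel \<partial>lborel) = I * emeasure lborel \<Omega>"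
  proof -
    have "(\<integral>\<^sup>+ y. ennreal (indicator \<Omega> x * T (x - y)) \<partial>lborel) = I * indicator \<Omega> x" for x
      using slice[of x] by (cases "x \<in> \<Omega>") auto
    then show ?thesis by (simp add: nn_integral_cmult)
  qed
  have "(\<integral>\<^sup>+ z. ennreal (gagliardo_integrand s w w z) \<partial>lborel)
     \<le> (\<integral>\<^sup>+ z. ennreal C * (ennreal (indicator \<Omega> (fst z) * T (fst z - snd z))
            + ennreal (indicator \<Omega> (snd z) * T (snd z - fst z))) \<partial>lborel)"
  proof (rule nn_integral_mono)
    fix z :: "(real ^ 'n) \<times> (real ^ 'n)"
    obtain x y where z: "z = (x, y)" by (cases z)
    show "ennreal (gagliardo_integrand s w w z)
      \<le> ennreal C * (ennreal (indicator \<Omega> (fst z) * T (fst z - snd z))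
            + ennreal (indicator \<Omega> (snd z) * T (snd z - fst z)))"
      using ennreal_leI[OF pt[of x y]] T_nonneg D
      by (simp add: z C_def ennreal_mult' ennreal_plus)
  qed
  also have "\<dots> = ennreal C * (I * emeasure lborel \<Omega> + I * emeasure lborel \<Omega>)"
  proof -
    have m1: "(\<lambda>z. ennreal (indicator \<Omega> (fst z) * T (fst z - snd z))) \<in> borel_measurable (borel \<Otimes>\<^sub>M borel)"
      by measurable
    have m2: "(\<lambda>z. ennreal (indicator \<Omega> (snd z) * T (snd z - fst z))) \<in> borel_measurable (borel \<Otimes>\<^sub>M borel)"
      by measurable
    have 1: "(\<integral>\<^sup>+ z. ennreal (indicator \<Omega> (fst z) * T (fst z - snd z)) \<partial>lborel) = I * emeasure lborel \<Omega>"
      using half by (subst nn_integral_pair_lborel(1)) (use m1 in \<open>auto simp: borel_prod\<close>)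
    have 2: "(\<integral>\<^sup>+ z. ennreal (indicator \<Omega> (snd z) * T (snd z - fst z)) \<partial>lborel) = I * emeasure lborel \<Omega>"
      using half by (subst nn_integral_pair_lborel(2)) (use m2 in \<open>auto simp: borel_prod\<close>)
    show ?thesis
      using m1 m2 by (simp add: nn_integral_cmult nn_integral_add borel_prod 1 2)
  qed
  also have "\<dots> < \<infinity>"
    using I \<Omega>(2) by (simp add: ennreal_mult_less_top less_top[symmetric] ennreal_mult_eq_top_iff)
  finally have "integrable lborel (gagliardo_integrand s w w)"
    by (intro integrableI_nonneg) (auto simp: gagliardo_integrand_nonneg)
  moreover have "integrable lborel (\<lambda>x. (w x)\<^sup>2)"
  proof (rule Bochner_Integration.integrable_bound)
    show "integrable lborel (\<lambda>x. D\<^sup>2 * indicator \<Omega> x :: real)"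
      using \<Omega> by (intro integrable_mult_right integrable_real_indicator) auto
    show "AE x in lborel. norm ((w x)\<^sup>2) \<le> norm (D\<^sup>2 * indicator \<Omega> x :: real)"
    proof (intro always_eventually allI)
      fix x
      show "norm ((w x)\<^sup>2) \<le> norm (D\<^sup>2 * indicator \<Omega> x :: real)"
        using power_mono[OF bound[of x], of 2] w0[of x] by (cases "x \<in> \<Omega>") auto
    qed
  qed simp
  ultimately show ?thesis
    by (auto simp: energy_space_def w0)
qed

text \<open>
  The distance to the complement of \<Omega>. It makes the embedding constant positive and serves as
  the direction that detects zeros of the minimiser.
\<close>
lemma ex_positive_in_energy_space:
  fixes \<Omega> :: "(real ^ 'n) set"
  assumes s: "0 < s" "s < 1" and \<Omega>: "open \<Omega>" "bounded \<Omega>"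
  obtains w D where "w \<in> energy_space s \<Omega>" "\<And>x. x \<in> \<Omega> \<Longrightarrow> w x > 0" "\<And>x. 0 \<le> w x \<and> w x \<le> D"
proof -
  define w where "w x = infdist x (- \<Omega>)" for x
  have ne: "- \<Omega> \<noteq> {}"
    using \<Omega>(2) not_bounded_UNIV by (metis Compl_empty_eq double_compl)
  obtain R where R: "\<And>x. x \<in> \<Omega> \<Longrightarrow> norm x \<le> R"
    using \<Omega>(2) by (auto simp: bounded_iff)
  obtain p where p: "p \<in> - \<Omega>" using ne by auto
  have w0: "w x = 0" if "x \<notin> \<Omega>" for x
    using that by (simp add: w_def)
  have wD: "w x \<le> \<bar>R\<bar> + norm p" for x
  proof (cases "x \<in> \<Omega>")
    case True
    have "w x \<le> dist x p" unfolding w_def by (rule infdist_le[OF p])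
    also have "\<dots> \<le> norm x + norm p" by (simp add: dist_norm norm_triangle_ineq4)
    also have "\<dots> \<le> \<bar>R\<bar> + norm p" using R[OF True] by simp
    finally show ?thesis .
  qed (simp add: w0 add_nonneg_nonneg)
  have "w \<in> energy_space s \<Omega>"
  proof (rule lipschitz_in_energy_space[OF s])
    show "emeasure lborel \<Omega> < \<infinity>" by (rule emeasure_bounded_finite[OF \<Omega>(2)])
    show "\<bar>w x - w y\<bar> \<le> norm (x - y)" for x y
      unfolding w_def dist_norm[symmetric] by (rule infdist_triangle_abs)
    show "\<bar>w x\<bar> \<le> \<bar>R\<bar> + norm p" for x
      using wD[of x] by (simp add: w_def infdist_nonneg)
  qed (use \<Omega>(1) w0 in auto)
  moreover have "w x > 0" if "x \<in> \<Omega>" for x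
  proof -
    have "closed (- \<Omega>)" using \<Omega>(1) by (simp add: closed_Compl)
    then have "w x \<noteq> 0" unfolding w_def using in_closed_iff_infdist_zero[OF _ ne] that by auto
    then show ?thesis using infdist_nonneg[of x "- \<Omega>"] by (simp add: w_def)
  qed
  ultimately show ?thesis using that wD by (metis infdist_nonneg w_def)
qed

section \<open>The fractional Sobolev inequality\<close>

text \<open>
  The second identity makes the optimal radius in the next estimate produce exactly the
  critical power; the third one then converts the resulting power of \<open>N\<close> into the one of the
  Sobolev inequality.
\<close>
lemma crit_exp_identities:
  fixes s :: real
  assumes "0 < s" "2 * s < real n"
  shows "2 < crit_exp n s" "2 + 2 * s * crit_exp n s / real n = crit_exp n s"
    "1 - 2 * s / real n = 2 / crit_exp n s"
  using assms by (simp_all add: crit_exp_def field_simps)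

lemma energy_ennreal:
  fixes u :: "real ^ 'n \<Rightarrow> real"
  assumes "integrable lborel (gagliardo_integrand s u u)"
  shows "(\<integral>\<^sup>+ z. ennreal (gagliardo_integrand s u u z) \<partial>lborel) = ennreal (energy s u u)"
  unfolding energy_def
  by (rule nn_integral_eq_integral[OF assms]) (simp add: gagliardo_integrand_nonneg)

text \<open>
  Let \<open>a = \<bar>u x\<bar>\<close>. The radius \<open>R\<close> is chosen such that the ball \<open>B\<close> has twice the volume that
  Markov's inequality allows for the set where \<open>\<bar>u\<bar>\<close> exceeds \<open>a / 2\<close>. On the rest \<open>G\<close>, at
  least half of the ball, \<open>u\<close> differs from \<open>u x\<close> by at least \<open>a / 2\<close>, at distance less than
  \<open>R\<close>.
\<close>
lemma pointwise_sobolev_estimate: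
  fixes u :: "real ^ 'n \<Rightarrow> real" and s :: real
  defines "n \<equiv> CARD('n)"
  defines "p \<equiv> crit_exp n s"
  defines "\<omega> \<equiv> unit_ball_vol (real n)"
  assumes s: "0 < s" "2 * s < real n"
    and [measurable]: "u \<in> borel_measurable borel"
    and up: "integrable lborel (\<lambda>x. \<bar>u x\<bar> powr p)"
    and N: "0 < (LINT x|lborel. \<bar>u x\<bar> powr p)"
  shows "ennreal (\<omega> / 8 * (2 * 2 powr p / \<omega>) powr (- (2 * s / n))
            * (LINT x|lborel. \<bar>u x\<bar> powr p) powr (- (2 * s / n)) * \<bar>u x\<bar> powr p)
      \<le> (\<integral>\<^sup>+ y. ennreal (gagliardo_integrand s u u (x, y)) \<partial>lborel)"
proof (cases "u x = 0")
  case True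
  then show ?thesis by simp
next
  case False
  define a where "a = \<bar>u x\<bar>"
  define N where "N = (LINT x|lborel. \<bar>u x\<bar> powr p)"
  have a: "0 < a" using False by (simp add: a_def)
  have n: "0 < n" by (simp add: n_def)
  have \<omega>: "0 < \<omega>" by (simp add: \<omega>_def)
  have N0: "0 < N" using N by (simp add: N_def)
  have p: "2 < p" using crit_exp_identities(1)[OF s] by (simp add: p_def)
  define V where "V = 2 * 2 powr p * N / a powr p"
  define R where "R = (V / \<omega>) powr (1 / n)"
  have V: "0 < V" using N0 a by (simp add: V_def)
  have R: "0 < R" using V \<omega> by (simp add: R_def)
  have Rn: "R ^ n = V / \<omega>"
    using V \<omega> n R by (simp add: R_def powr_powr flip: powr_realpow)
  define B where "B = ball x R"
  define G where "G = {y \<in> B. \<bar>u y\<bar> \<le> a / 2}"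
  define H where "H = {y \<in> B. a / 2 < \<bar>u y\<bar>}"
  have [measurable]: "B \<in> sets borel" "G \<in> sets borel" "H \<in> sets borel"
    unfolding B_def G_def H_def by measurable
  have B: "emeasure lborel B = ennreal V"
  proof -
    have "emeasure lborel B = ennreal (\<omega> * R ^ n)"
      using R by (simp add: B_def emeasure_ball \<omega>_def n_def)
    also have "\<omega> * R ^ n = V" using Rn \<omega> by simp
    finally show ?thesis .
  qed
  have fin: "G \<in> fmeasurable lborel" "H \<in> fmeasurable lborel"
  proof -
    have "B \<in> fmeasurable lborel" using B by (simp add: fmeasurable_def)
    moreover have "G \<subseteq> B" "H \<subseteq> B" by (auto simp: G_def H_def)
    ultimately show "G \<in> fmeasurable lborel" "H \<in> fmeasurable lborel"
      by (auto intro: fmeasurableI2)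
  qed
  have "measure lborel B = measure lborel G + measure lborel H"
  proof -
    have "B = G \<union> H" by (auto simp: G_def H_def)
    moreover have "G \<inter> H = {}" by (auto simp: G_def H_def)
    ultimately show ?thesis
      using measure_Un3[OF fin] by simp
  qed
  then have VGH: "V = measure lborel G + measure lborel H"
    using B V by (simp add: measure_def)
  have "(a / 2) powr p * measure lborel H = (LINT y|lborel. (a / 2) powr p * indicator H y)"
    by simp
  also have "\<dots> \<le> N"
    unfolding N_def
  proof (rule integral_mono[OF _ up])
    show "integrable lborel (\<lambda>y. (a / 2) powr p * indicator H y)"
      using fin(2) by (intro integrable_mult_right integrable_real_indicator) (auto simp: fmeasurable_def)
    show "(a / 2) powr p * indicator H y \<le> \<bar>u y\<bar> powr p" for y
      using powr_mono2[of p "a / 2" "\<bar>u y\<bar>"] p a by (auto simp: indicator_def H_def)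
  qed
  finally have "measure lborel H \<le> V / 2"
    using a by (simp add: V_def powr_divide field_simps)
  with VGH have G: "V / 2 \<le> measure lborel G" by simp
  define d where "d = real n + 2 * s"
  have "ennreal ((a / 2)\<^sup>2 / R powr d) * ennreal (V / 2)
      \<le> ennreal ((a / 2)\<^sup>2 / R powr d) * emeasure lborel G"
    using G fin(1) by (intro mult_left_mono) (auto simp: emeasure_eq_measure2 intro: ennreal_leI)
  also have "\<dots> = (\<integral>\<^sup>+ y. ennreal ((a / 2)\<^sup>2 / R powr d) * indicator G y \<partial>lborel)"
    by (simp add: nn_integral_cmult_indicator)
  also have "\<dots> \<le> (\<integral>\<^sup>+ y. ennreal (gagliardo_integrand s u u (x, y)) \<partial>lborel)"
  proof (rule nn_integral_mono)
    fix y
    show "ennreal ((a / 2)\<^sup>2 / R powr d) * indicator G y \<le> ennreal (gagliardo_integrand s u u (x, y))"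
    proof (cases "y \<in> G")
      case True
      then have y: "norm (x - y) < R" "\<bar>u y\<bar> \<le> a / 2"
        by (auto simp: G_def B_def dist_norm)
      have "x \<noteq> y" using y(2) a by (auto simp: a_def)
      then have pos: "0 < norm (x - y)" by simp
      have "a / 2 \<le> \<bar>u x - u y\<bar>" using y(2) unfolding a_def by linarith
      then have "(a / 2)\<^sup>2 \<le> \<bar>u x - u y\<bar>\<^sup>2" using a by (intro power_mono) auto
      then have 1: "(a / 2)\<^sup>2 \<le> (u x - u y) * (u x - u y)" by (simp add: power2_eq_square)
      have 2: "norm (x - y) powr d \<le> R powr d"
        using y(1) s by (intro powr_mono2) (auto simp: d_def)
      have "(a / 2)\<^sup>2 / R powr d \<le> gagliardo_integrand s u u (x, y)"
        unfolding gagliardo_integrand_eq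
        using 1 2 pos by (intro frac_le) (auto simp: d_def n_def)
      then show ?thesis using True by (simp add: ennreal_leI)
    qed simp
  qed
  finally have *: "ennreal ((a / 2)\<^sup>2 / R powr d * (V / 2))
      \<le> (\<integral>\<^sup>+ y. ennreal (gagliardo_integrand s u u (x, y)) \<partial>lborel)"
    using V by (simp flip: ennreal_mult')
  \<comment> \<open>It remains to express the bound through \<open>a\<close> and \<open>N\<close> by inserting the value of \<open>R\<close>.\<close>
  have "V / R powr d = \<omega> * R powr (- (2 * s))"
    using R \<omega> Rn by (simp add: d_def powr_add powr_minus powr_realpow field_simps)
  moreover have "R powr (- (2 * s)) = (V / \<omega>) powr (- (2 * s / n))"
    by (simp add: R_def powr_powr)
  moreover have "(V / \<omega>) powr (- (2 * s / n))
      = (2 * 2 powr p / \<omega>) powr (- (2 * s / n)) * N powr (- (2 * s / n)) * a powr (p * (2 * s / n))"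
  proof -
    have "V / \<omega> = (2 * 2 powr p / \<omega>) * N * (a powr (- p))"
      using a by (simp add: V_def powr_minus field_simps)
    show ?thesis
      unfolding \<open>V / \<omega> = _\<close> by (simp only: powr_mult powr_powr) simp
  qed
  moreover have "a\<^sup>2 * a powr (p * (2 * s / n)) = a powr p"
  proof -
    have "a\<^sup>2 * a powr (p * (2 * s / n)) = a powr (2 + p * (2 * s / n))"
      using a by (simp add: powr_add)
    also have "2 + p * (2 * s / n) = p"
      using crit_exp_identities(2)[OF s] by (simp add: p_def mult.commute)
    finally show ?thesis .
  qed
  ultimately have E: "(a / 2)\<^sup>2 / R powr d * (V / 2)
     = \<omega> / 8 * (2 * 2 powr p / \<omega>) powr (- (2 * s / n)) * N powr (- (2 * s / n)) * a powr p"
  proof -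
    assume 1: "V / R powr d = \<omega> * R powr (- (2 * s))"
      and 2: "R powr (- (2 * s)) = (V / \<omega>) powr (- (2 * s / n))"
      and 3: "(V / \<omega>) powr (- (2 * s / n))
      = (2 * 2 powr p / \<omega>) powr (- (2 * s / n)) * N powr (- (2 * s / n)) * a powr (p * (2 * s / n))"
      and 4: "a\<^sup>2 * a powr (p * (2 * s / n)) = a powr p"
    have "(a / 2)\<^sup>2 / R powr d * (V / 2) = a\<^sup>2 / 8 * (V / R powr d)"
      by (simp add: power_divide)
    also have "\<dots> = \<omega> / 8 * (2 * 2 powr p / \<omega>) powr (- (2 * s / n)) * N powr (- (2 * s / n))
        * (a\<^sup>2 * a powr (p * (2 * s / n)))"
      unfolding 1 2 3 by simp
    finally show ?thesis unfolding 4 .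
  qed
  show ?thesis using * unfolding E by (simp only: N_def a_def)
qed

text \<open>
  Integrating the pointwise estimate bounds \<open>N * N powr (- (2 * s / n))\<close> by the energy. As \<open>N\<close>
  is finite, the two powers combine to the power \<open>2 / p\<close>.
\<close>
theorem fractional_sobolev_inequality:
  fixes s :: real
  assumes s: "0 < s" "2 * s < real CARD('n)"
  obtains K :: real where "0 < K"
    "\<And>u :: real ^ 'n \<Rightarrow> real. \<lbrakk>u \<in> borel_measurable borel; integrable lborel (gagliardo_integrand s u u);
        integrable lborel (\<lambda>x. \<bar>u x\<bar> powr crit_exp CARD('n) s)\<rbrakk>
      \<Longrightarrow> K * (LINT x|lborel. \<bar>u x\<bar> powr crit_exp CARD('n) s) powr (2 / crit_exp CARD('n) s) \<le> energy s u u"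
proof
  let ?n = "real CARD('n)"
  let ?p = "crit_exp CARD('n) s"
  let ?w = "unit_ball_vol ?n"
  let ?K = "?w / 8 * (2 * 2 powr ?p / ?w) powr (- (2 * s / ?n))"
  have w: "0 < ?w" by simp
  have "0 < 2 * 2 powr ?p / ?w" by (intro divide_pos_pos w) simp
  then have "0 < (2 * 2 powr ?p / ?w) powr (- (2 * s / ?n))"
    by (metis less_irrefl powr_gt_zero)
  then show K: "0 < ?K" by (intro mult_pos_pos divide_pos_pos w) simp_all
  fix u :: "real ^ 'n \<Rightarrow> real"
  assume [measurable]: "u \<in> borel_measurable borel"
    and gag: "integrable lborel (gagliardo_integrand s u u)"
    and up: "integrable lborel (\<lambda>x. \<bar>u x\<bar> powr ?p)"
  define N where "N = (LINT x|lborel. \<bar>u x\<bar> powr ?p)"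
  have "0 \<le> N" unfolding N_def by (rule Bochner_Integration.integral_nonneg) simp
  show "?K * (LINT x|lborel. \<bar>u x\<bar> powr ?p) powr (2 / ?p) \<le> energy s u u"
  proof (cases "N = 0")
    case True
    then show ?thesis using energy_self_nonneg[of s u] by (simp add: N_def)
  next
    case False
    with \<open>0 \<le> N\<close> have N: "0 < N" by simp
    have "ennreal (?K * N powr (- (2 * s / ?n)) * N)
        = (\<integral>\<^sup>+ x. ennreal (?K * N powr (- (2 * s / ?n)) * \<bar>u x\<bar> powr ?p) \<partial>lborel)"
    proof (subst nn_integral_eq_integral)
      show "integrable lborel (\<lambda>x. ?K * N powr (- (2 * s / ?n)) * \<bar>u x\<bar> powr ?p)"
        using up by (rule integrable_mult_right)
    next
      show "AE x in lborel. 0 \<le> ?K * N powr (- (2 * s / ?n)) * \<bar>u x\<bar> powr ?p"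
        using K by (intro always_eventually allI mult_nonneg_nonneg) simp_all
    qed (simp add: N_def)
    also have "\<dots> \<le> (\<integral>\<^sup>+ x. \<integral>\<^sup>+ y. ennreal (gagliardo_integrand s u u (x, y)) \<partial>lborel \<partial>lborel)"
      unfolding N_def
      by (intro nn_integral_mono pointwise_sobolev_estimate s up) (use N in \<open>simp_all add: N_def\<close>)
    also have "\<dots> = (\<integral>\<^sup>+ z. ennreal (gagliardo_integrand s u u z) \<partial>lborel)"
      by (rule nn_integral_pair_lborel(1)[symmetric]) simp
    also have "\<dots> = ennreal (energy s u u)"
      by (rule energy_ennreal[OF gag])
    finally have "?K * N powr (- (2 * s / ?n)) * N \<le> energy s u u"
      using energy_self_nonneg[of s u] by (simp add: ennreal_le_iff)
    moreover have "N powr (- (2 * s / ?n)) * N = N powr (2 / ?p)"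
    proof -
      have "N powr (- (2 * s / ?n)) * N = N powr (- (2 * s / ?n)) * N powr 1"
        using N by simp
      also have "\<dots> = N powr (1 - 2 * s / ?n)"
        unfolding powr_add[symmetric] by (simp add: algebra_simps)
      finally show ?thesis unfolding crit_exp_identities(3)[OF s] .
    qed
    ultimately show ?thesis by (simp add: N_def mult.assoc)
  qed
qed

section \<open>Compactness of sequences with bounded energy\<close>

text \<open>
  The cells are the half-open cubes of the grid of mesh \<open>1 / Suc m\<close>.
\<close>
definition same_cell :: "nat \<Rightarrow> real ^ 'n \<Rightarrow> real ^ 'n \<Rightarrow> bool" where
  "same_cell m x y \<longleftrightarrow> (\<forall>i. \<lfloor>real (Suc m) * x $ i\<rfloor> = \<lfloor>real (Suc m) * y $ i\<rfloor>)"

lemma same_cell_measurable [measurable]: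
  "Measurable.pred (borel \<Otimes>\<^sub>M borel) (\<lambda>z. same_cell m (fst z) (snd z :: real ^ 'n))"
proof -
  have [measurable]: "(\<lambda>x :: real ^ 'n. x $ i) \<in> borel_measurable borel" for i
    by (intro borel_measurable_continuous_onI continuous_intros)
  show ?thesis unfolding same_cell_def by measurable
qed

lemma same_cell_slice_measurable [measurable]:
  "Measurable.pred borel (same_cell m (x :: real ^ 'n))"
proof -
  have [measurable]: "(\<lambda>x :: real ^ 'n. x $ i) \<in> borel_measurable borel" for i
    by (intro borel_measurable_continuous_onI continuous_intros)
  show ?thesis unfolding same_cell_def by measurable
qed

lemma same_cell_norm:
  fixes x y :: "real ^ 'n"
  assumes "same_cell m x y"
  shows "norm (x - y) \<le> real CARD('n) / real (Suc m)"
proof -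
  have "\<bar>(x - y) $ i\<bar> \<le> 1 / real (Suc m)" for i
  proof -
    have "\<lfloor>real (Suc m) * x $ i\<rfloor> = \<lfloor>real (Suc m) * y $ i\<rfloor>"
      using assms by (simp add: same_cell_def)
    then have "\<bar>real (Suc m) * x $ i - real (Suc m) * y $ i\<bar> \<le> 1" by linarith
    then have "real (Suc m) * \<bar>x $ i - y $ i\<bar> \<le> 1"
      by (simp only: right_diff_distrib[symmetric] abs_mult)
    then show ?thesis by (simp add: field_simps)
  qed
  then have "(\<Sum>i\<in>UNIV. \<bar>(x - y) $ i\<bar>) \<le> (\<Sum>i\<in>(UNIV :: 'n set). 1 / real (Suc m))"
    by (intro sum_mono)
  then show ?thesis
    using norm_le_l1_cart[of "x - y"] by simp
qed

lemma emeasure_cell: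
  fixes x :: "real ^ 'n"
  shows "emeasure lborel {y. same_cell m x y} = ennreal ((1 / real (Suc m)) ^ CARD('n))"
proof -
  define \<delta> where "\<delta> = 1 / real (Suc m)"
  define l where "l = (\<chi> i. \<delta> * real_of_int \<lfloor>real (Suc m) * x $ i\<rfloor>)"
  define u where "u = (\<chi> i. l $ i + \<delta>)"
  have \<delta>: "\<delta> > 0" by (simp add: \<delta>_def)
  have cell: "same_cell m x y \<longleftrightarrow> (\<forall>i. l $ i \<le> y $ i \<and> y $ i < u $ i)" for y
  proof -
    have "\<lfloor>real (Suc m) * x $ i\<rfloor> = \<lfloor>real (Suc m) * y $ i\<rfloor> \<longleftrightarrow> l $ i \<le> y $ i \<and> y $ i < u $ i" for i
    proof -
      have "\<lfloor>real (Suc m) * y $ i\<rfloor> = \<lfloor>real (Suc m) * x $ i\<rfloor> \<longleftrightarrow>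
         real_of_int \<lfloor>real (Suc m) * x $ i\<rfloor> \<le> real (Suc m) * y $ i
         \<and> real (Suc m) * y $ i < real_of_int \<lfloor>real (Suc m) * x $ i\<rfloor> + 1"
        by linarith
      then show ?thesis
        by (auto simp: l_def u_def \<delta>_def field_simps)
    qed
    then show ?thesis by (simp add: same_cell_def)
  qed
  have lu: "l \<bullet> b \<le> u \<bullet> b" "(u - l) \<bullet> b = \<delta>" if b: "b \<in> Basis" for b
  proof -
    obtain i where "b = axis i 1" using b by (auto simp: Basis_vec_def)
    then show "l \<bullet> b \<le> u \<bullet> b" "(u - l) \<bullet> b = \<delta>"
      using \<delta> by (simp_all add: inner_axis u_def)
  qed
  have pr: "(\<Prod>b\<in>Basis. (u - l) \<bullet> b) = \<delta> ^ CARD('n)"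
    using lu by simp
  have "box l u \<subseteq> {y. same_cell m x y}" "{y. same_cell m x y} \<subseteq> cbox l u"
    by (auto simp: cell mem_box_cart less_imp_le)
  then have "emeasure lborel (box l u) \<le> emeasure lborel {y. same_cell m x y}"
    "emeasure lborel {y. same_cell m x y} \<le> emeasure lborel (cbox l u)"
    by (auto intro!: emeasure_mono)
  moreover have "emeasure lborel (box l u) = ennreal (\<delta> ^ CARD('n))"
    using lu pr by (subst emeasure_lborel_box) auto
  moreover have "emeasure lborel (cbox l u) = ennreal (\<delta> ^ CARD('n))"
    using lu pr by (subst emeasure_lborel_cbox) auto
  ultimately show ?thesis unfolding \<delta>_def by (intro antisym) auto
qed

definition cell_average :: "nat \<Rightarrow> (real ^ 'n \<Rightarrow> real) \<Rightarrow> real ^ 'n \<Rightarrow> real" where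
  "cell_average m u x = (LINT y|lborel. u y * of_bool (same_cell m x y)) / (1 / real (Suc m)) ^ CARD('n)"

lemma integrable_cell:
  fixes u :: "real ^ 'n \<Rightarrow> real"
  assumes [measurable]: "u \<in> borel_measurable borel" and bd: "\<And>y. \<bar>u y\<bar> \<le> M"
  shows "integrable lborel (\<lambda>y. u y * of_bool (same_cell m x y))"
    and "\<bar>LINT y|lborel. u y * of_bool (same_cell m x y)\<bar> \<le> M * (1 / real (Suc m)) ^ CARD('n)"
proof -
  have "integrable lborel (indicator {y. same_cell m x y} :: real ^ 'n \<Rightarrow> real)"
    by (rule integrable_real_indicator) (simp_all add: emeasure_cell)
  then have i: "integrable lborel (\<lambda>y. M * indicator {y. same_cell m x y} y)"
    by (rule integrable_mult_right)
  have b: "norm (u y * of_bool (same_cell m x y)) \<le> M * indicator {y. same_cell m x y} y" for y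
    using bd[of y] by (simp add: abs_mult)
  show 1: "integrable lborel (\<lambda>y. u y * of_bool (same_cell m x y))"
    by (rule Bochner_Integration.integrable_bound[OF i])
       (auto intro!: always_eventually intro: order_trans[OF bd abs_ge_self])
  have "norm (LINT y|lborel. u y * of_bool (same_cell m x y))
      \<le> (LINT y|lborel. M * indicator {y. same_cell m x y} y)"
    by (rule Bochner_Integration.integral_norm_bound_integral[OF 1 i]) (use b in auto)
  then show "\<bar>LINT y|lborel. u y * of_bool (same_cell m x y)\<bar> \<le> M * (1 / real (Suc m)) ^ CARD('n)"
    by (simp add: measure_def emeasure_cell)
qed

lemma cell_average_measurable [measurable]:
  fixes u :: "real ^ 'n \<Rightarrow> real"
  assumes [measurable]: "u \<in> borel_measurable borel"
  shows "cell_average m u \<in> borel_measurable borel"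
proof -
  have "(\<lambda>z. u (snd z) * of_bool (same_cell m (fst z) (snd z))) \<in> borel_measurable (borel \<Otimes>\<^sub>M borel)"
    by measurable
  then have "(\<lambda>(x, y). u y * of_bool (same_cell m x y)) \<in> borel_measurable (borel \<Otimes>\<^sub>M lborel)"
    by (simp add: case_prod_beta' cong: measurable_cong_sets)
  from lborel.borel_measurable_lebesgue_integral[OF this] show ?thesis
    unfolding cell_average_def by measurable
qed

lemma cell_average_bound:
  fixes u :: "real ^ 'n \<Rightarrow> real"
  assumes "u \<in> borel_measurable borel" "\<And>y. \<bar>u y\<bar> \<le> M"
  shows "\<bar>cell_average m u x\<bar> \<le> M"
proof -
  have "0 < (1 / real (Suc m)) ^ CARD('n)" by simp
  with integrable_cell(2)[OF assms, of m x] show ?thesis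
    unfolding cell_average_def abs_divide by (simp add: divide_le_eq del: of_nat_Suc)
qed

text \<open>
  The average over the cell of \<open>x\<close> involves only differences \<open>u x - u y\<close> at distance at most
  the cell diameter \<rho>. By \<open>\<bar>t\<bar> \<le> \<eta> + t\<^sup>2 / \<eta>\<close> they are controlled by the Gagliardo integrand,
  at the price of the factor \<open>\<rho> powr d\<close> for removing the kernel.
\<close>
lemma cell_average_pointwise:
  fixes u :: "real ^ 'n \<Rightarrow> real" and m :: nat
  assumes s: "0 < s" and [measurable]: "u \<in> borel_measurable borel" and bd: "\<And>y. \<bar>u y\<bar> \<le> M" and \<eta>: "\<eta> > 0"
  defines "K \<equiv> (real CARD('n) / real (Suc m)) powr (real CARD('n) + 2 * s) / (1 / real (Suc m)) ^ CARD('n)"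
  shows "ennreal \<bar>u x - cell_average m u x\<bar>
     \<le> ennreal \<eta> + ennreal (K / \<eta>) * (\<integral>\<^sup>+ y. ennreal (gagliardo_integrand s u u (x, y)) \<partial>lborel)"
proof -
  define \<mu> where "\<mu> = (1 / real (Suc m)) ^ CARD('n)"
  define \<rho> where "\<rho> = real CARD('n) / real (Suc m)"
  define d where "d = real CARD('n) + 2 * s"
  have \<mu>: "\<mu> > 0" by (simp add: \<mu>_def)
  have \<rho>: "\<rho> > 0" by (simp add: \<rho>_def)
  have d: "d > 0" using s by (simp add: d_def add_pos_pos)
  have K: "K = \<rho> powr d / \<mu>" by (simp add: K_def \<mu>_def \<rho>_def d_def)
  let ?c = "\<lambda>y. of_bool (same_cell m x y) :: real"
  have bd': "\<bar>u x - u y\<bar> \<le> 2 * M" for y using bd[of x] bd[of y] by linarith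
  have cell: "(LINT y|lborel. ?c y) = \<mu>" "integrable lborel ?c"
  proof -
    have eq: "?c = indicator {y. same_cell m x y}" by (auto simp: indicator_def)
    show "(LINT y|lborel. ?c y) = \<mu>"
      by (simp add: eq measure_def emeasure_cell \<mu>_def)
    show "integrable lborel ?c"
      unfolding eq by (rule integrable_real_indicator) (simp_all add: emeasure_cell)
  qed
  have "(LINT y|lborel. (u x - u y) * ?c y) = u x * \<mu> - (LINT y|lborel. u y * ?c y)"
    using cell integrable_cell(1)[of u M m x] bd
    by (simp add: left_diff_distrib)
  then have "u x - cell_average m u x = (LINT y|lborel. (u x - u y) * ?c y) / \<mu>"
    using \<mu> unfolding cell_average_def \<mu>_def[symmetric] by (simp add: diff_divide_distrib)
  also have "\<dots> = (LINT y|lborel. (u x - u y) * ?c y / \<mu>)" by simp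
  finally have "ennreal \<bar>u x - cell_average m u x\<bar> = ennreal (norm (LINT y|lborel. (u x - u y) * ?c y / \<mu>))"
    by simp
  also have "\<dots> \<le> (\<integral>\<^sup>+ y. ennreal (norm ((u x - u y) * ?c y / \<mu>)) \<partial>lborel)"
  proof (rule integral_norm_bound_ennreal)
    show "integrable lborel (\<lambda>y. (u x - u y) * ?c y / \<mu>)"
      by (intro integrable_divide integrable_cell(1)[of "\<lambda>y. u x - u y" "2 * M"]) (use bd' in auto)
  qed
  also have "\<dots> \<le> (\<integral>\<^sup>+ y. ennreal (\<eta> / \<mu> * ?c y) + ennreal (K / \<eta>) * ennreal (gagliardo_integrand s u u (x, y)) \<partial>lborel)"
  proof (rule nn_integral_mono)
    fix y
    show "ennreal (norm ((u x - u y) * ?c y / \<mu>))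
       \<le> ennreal (\<eta> / \<mu> * ?c y) + ennreal (K / \<eta>) * ennreal (gagliardo_integrand s u u (x, y))"
    proof (cases "same_cell m x y")
      case True
      have "(u x - u y)\<^sup>2 \<le> \<rho> powr d * gagliardo_integrand s u u (x, y)"
      proof (cases "x = y")
        case False
        then have "0 < norm (x - y)" by simp
        moreover have "norm (x - y) powr d \<le> \<rho> powr d"
          using same_cell_norm[OF True] d by (intro powr_mono2) (auto simp: \<rho>_def)
        then have "(u x - u y)\<^sup>2 * norm (x - y) powr d \<le> \<rho> powr d * (u x - u y)\<^sup>2"
          by (subst mult.commute) (intro mult_right_mono, auto)
        ultimately show ?thesis
          by (simp add: gagliardo_integrand_eq power2_eq_square le_divide_eq flip: d_def)
      qed (simp add: gagliardo_integrand_eq)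
      moreover have "\<bar>u x - u y\<bar> \<le> \<eta> + (u x - u y)\<^sup>2 / \<eta>"
      proof -
        have "0 \<le> (\<bar>u x - u y\<bar> - \<eta>)\<^sup>2" by simp
        then have "2 * (\<bar>u x - u y\<bar> * \<eta>) \<le> \<eta>\<^sup>2 + (u x - u y)\<^sup>2"
          by (simp add: power2_diff algebra_simps)
        moreover have "0 \<le> \<bar>u x - u y\<bar> * \<eta>" using \<eta> by simp
        ultimately have "\<bar>u x - u y\<bar> * \<eta> \<le> \<eta>\<^sup>2 + (u x - u y)\<^sup>2" by linarith
        then show ?thesis using \<eta> by (simp add: field_simps power2_eq_square)
      qed
      ultimately have "\<bar>u x - u y\<bar> \<le> \<eta> + \<rho> powr d * gagliardo_integrand s u u (x, y) / \<eta>"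
        using \<eta> by (smt (verit) divide_right_mono)
      then have "\<bar>u x - u y\<bar> / \<mu> \<le> \<eta> / \<mu> + K / \<eta> * gagliardo_integrand s u u (x, y)"
        using \<mu> by (simp add: K field_simps)
      then have "ennreal (\<bar>u x - u y\<bar> / \<mu>) \<le> ennreal (\<eta> / \<mu> + K / \<eta> * gagliardo_integrand s u u (x, y))"
        by (rule ennreal_leI)
      also have "\<dots> = ennreal (\<eta> / \<mu>) + ennreal (K / \<eta>) * ennreal (gagliardo_integrand s u u (x, y))"
        using \<mu> \<eta> by (subst ennreal_plus) (auto simp: K gagliardo_integrand_nonneg simp flip: ennreal_mult)
      finally show ?thesis
        using True \<mu> by (simp add: abs_mult)
    qed simp
  qed
  also have "\<dots> = ennreal \<eta> + ennreal (K / \<eta>) * (\<integral>\<^sup>+ y. ennreal (gagliardo_integrand s u u (x, y)) \<partial>lborel)"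
  proof -
    have m: "(\<lambda>y. ennreal (gagliardo_integrand s u u (x, y))) \<in> borel_measurable lborel"
      unfolding gagliardo_integrand_eq by measurable
    have "(\<integral>\<^sup>+ y. ennreal (\<eta> / \<mu> * ?c y) \<partial>lborel) = ennreal \<eta>"
      by (subst nn_integral_eq_integral) (use cell \<mu> \<eta> in auto)
    then show ?thesis
      using m by (subst nn_integral_add) (simp_all add: nn_integral_cmult)
  qed
  finally show ?thesis .
qed

text \<open>
  \<open>K\<close> is of order \<open>m\<close> to the power \<open>- 2 * s\<close>: at fixed \<eta>, the averages on fine grids
  approximate \<open>u\<close> uniformly over all functions with a common energy bound.
\<close>
lemma cell_average_error:
  fixes u :: "real ^ 'n \<Rightarrow> real" and m :: nat
  assumes s: "0 < s" and u: "u \<in> energy_space s \<Omega>" and bd: "\<And>y. \<bar>u y\<bar> \<le> M" and \<eta>: "\<eta> > 0"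
    and [measurable]: "\<Omega> \<in> sets borel" and \<Omega>: "emeasure lborel \<Omega> < \<infinity>"
  defines "K \<equiv> (real CARD('n) / real (Suc m)) powr (real CARD('n) + 2 * s) / (1 / real (Suc m)) ^ CARD('n)"
  shows "(LINT x|lborel. indicator \<Omega> x * \<bar>u x - cell_average m u x\<bar>)
     \<le> \<eta> * measure lborel \<Omega> + K / \<eta> * energy s u u"
proof -
  note [measurable] = energy_spaceD(1)[OF u]
  have K: "0 \<le> K" by (simp add: K_def)
  have e: "0 \<le> energy s u u" by (rule energy_self_nonneg)
  have M: "0 \<le> M" using bd[of 0] by linarith
  have i: "integrable lborel (\<lambda>x. indicator \<Omega> x * \<bar>u x - cell_average m u x\<bar>)"
  proof (rule Bochner_Integration.integrable_bound)
    show "integrable lborel (\<lambda>x. 2 * M * indicator \<Omega> x :: real)"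
      using \<Omega> by (intro integrable_mult_right integrable_real_indicator) auto
    have "\<bar>u x - cell_average m u x\<bar> \<le> 2 * M" for x
      using bd[of x] cell_average_bound[OF energy_spaceD(1)[OF u] bd, of m x] by linarith
    then show "AE x in lborel. norm (indicator \<Omega> x * \<bar>u x - cell_average m u x\<bar>)
        \<le> norm (2 * M * indicator \<Omega> x :: real)"
      using M by (intro always_eventually) (auto simp: indicator_def)
  qed measurable
  have m: "(\<lambda>x. \<integral>\<^sup>+ y. ennreal (gagliardo_integrand s u u (x, y)) \<partial>lborel) \<in> borel_measurable lborel"
  proof -
    have "(\<lambda>z. ennreal (gagliardo_integrand s u u z)) \<in> borel_measurable (lborel \<Otimes>\<^sub>M lborel)"
      by (simp add: lborel_prod)
    from lborel.borel_measurable_nn_integral_fst[OF this] show ?thesis by simp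
  qed
  have "ennreal (LINT x|lborel. indicator \<Omega> x * \<bar>u x - cell_average m u x\<bar>)
      = (\<integral>\<^sup>+ x. ennreal (indicator \<Omega> x * \<bar>u x - cell_average m u x\<bar>) \<partial>lborel)"
    by (rule nn_integral_eq_integral[symmetric, OF i]) simp
  also have "\<dots> \<le> (\<integral>\<^sup>+ x. ennreal \<eta> * indicator \<Omega> x
      + ennreal (K / \<eta>) * (\<integral>\<^sup>+ y. ennreal (gagliardo_integrand s u u (x, y)) \<partial>lborel) \<partial>lborel)"
  proof (rule nn_integral_mono)
    fix x
    show "ennreal (indicator \<Omega> x * \<bar>u x - cell_average m u x\<bar>) \<le> ennreal \<eta> * indicator \<Omega> x
      + ennreal (K / \<eta>) * (\<integral>\<^sup>+ y. ennreal (gagliardo_integrand s u u (x, y)) \<partial>lborel)"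
      using cell_average_pointwise[OF s energy_spaceD(1)[OF u] bd \<eta>, of x m]
      by (cases "x \<in> \<Omega>") (simp_all add: K_def)
  qed
  also have "\<dots> = ennreal \<eta> * emeasure lborel \<Omega>
      + ennreal (K / \<eta>) * (\<integral>\<^sup>+ x. \<integral>\<^sup>+ y. ennreal (gagliardo_integrand s u u (x, y)) \<partial>lborel \<partial>lborel)"
    using m by (simp add: nn_integral_add nn_integral_cmult nn_integral_cmult_indicator)
  also have "(\<integral>\<^sup>+ x. \<integral>\<^sup>+ y. ennreal (gagliardo_integrand s u u (x, y)) \<partial>lborel \<partial>lborel) = ennreal (energy s u u)"
    using energy_ennreal[OF energy_spaceD(4)[OF u]]
    by (subst (asm) nn_integral_pair_lborel(1)) simp_all
  also have "emeasure lborel \<Omega> = ennreal (measure lborel \<Omega>)"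
    using \<Omega> by (simp add: emeasure_eq_ennreal_measure)
  also have "ennreal \<eta> * ennreal (measure lborel \<Omega>) + ennreal (K / \<eta>) * ennreal (energy s u u)
     = ennreal (\<eta> * measure lborel \<Omega> + K / \<eta> * energy s u u)"
    using \<eta> K e by (simp flip: ennreal_mult' ennreal_plus)
  finally show ?thesis
    using \<eta> K e by (subst (asm) ennreal_le_iff) auto
qed

text \<open>
  There are only countably many cells over all meshes, so a diagonal subsequence makes all
  cell averages converge. As averages approximate the functions uniformly well, the
  subsequence is Cauchy in \<open>L\<^sup>1\<close>, and a further subsequence converges almost everywhere.
\<close>
theorem bounded_energy_subsequence:
  fixes u :: "nat \<Rightarrow> real ^ 'n \<Rightarrow> real"
  assumes s: "0 < s" and u: "\<And>j. u j \<in> energy_space s \<Omega>" and bd: "\<And>j y. \<bar>u j y\<bar> \<le> M"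
    and C: "\<And>j. energy s (u j) (u j) \<le> C"
    and [measurable]: "\<Omega> \<in> sets borel" and \<Omega>: "emeasure lborel \<Omega> < \<infinity>"
  obtains r :: "nat \<Rightarrow> nat" where "strict_mono r" "AE x in lborel. convergent (\<lambda>j. u (r j) x)"
proof -
  have u_meas [measurable]: "u j \<in> borel_measurable borel" for j by (rule energy_spaceD(1)[OF u])
  \<comment> \<open>One representative point per cell index, so that the averages form a countable family.\<close>
  define grid where "grid m k = (SOME x. \<forall>i. \<lfloor>real (Suc m) * x $ i\<rfloor> = (k i :: int))" for m and k :: "'n \<Rightarrow> int"
  define f where "f j mk = cell_average (fst mk) (u j) (grid (fst mk) (snd mk))" for j mk
  have "norm (f j mk) \<le> M" for j mk
    unfolding f_def using cell_average_bound[of "u j" M] bd by auto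
  then obtain r1 where r1: "strict_mono (r1 :: nat \<Rightarrow> nat)"
    and "\<And>mk. mk \<in> UNIV \<Longrightarrow> \<exists>l. (\<lambda>j. f (r1 j) mk) \<longlonglongrightarrow> l"
    using function_convergent_subsequence[of UNIV f M] by (metis countableI_type)
  then have lim: "\<exists>l. (\<lambda>j. f (r1 j) mk) \<longlonglongrightarrow> l" for mk by auto
  have conv: "convergent (\<lambda>j. cell_average m (u (r1 j)) x)" for m x
  proof -
    define k where "k = (\<lambda>i. \<lfloor>real (Suc m) * x $ i\<rfloor>)"
    have "\<forall>i. \<lfloor>real (Suc m) * grid m k $ i\<rfloor> = k i"
      unfolding grid_def by (rule someI[of _ x]) (simp add: k_def)
    then have "same_cell m (grid m k) y \<longleftrightarrow> same_cell m x y" for y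
      by (simp add: same_cell_def k_def)
    then have "cell_average m v (grid m k) = cell_average m v x" for v
      by (simp add: cell_average_def)
    with lim[of "(m, k)"] show ?thesis
      by (simp add: f_def convergent_def)
  qed
  define w where "w j = u (r1 j)" for j
  have [measurable]: "w j \<in> borel_measurable borel" for j by (simp add: w_def)
  have bdw: "\<bar>w j y\<bar> \<le> M" for j y by (simp add: w_def bd)
  have i\<Omega>: "integrable lborel (\<lambda>x. c * indicator \<Omega> x :: real)" for c
    using \<Omega> by (intro integrable_mult_right integrable_real_indicator) auto
  have bdd_int: "integrable lborel (\<lambda>x. indicator \<Omega> x * h x)"
    if [measurable]: "h \<in> borel_measurable borel" and "\<And>x. \<bar>h x\<bar> \<le> c" for h :: "real ^ 'n \<Rightarrow> real" and c
  proof (rule Bochner_Integration.integrable_bound[OF i\<Omega>[of c]])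
    show "AE x in lborel. norm (indicator \<Omega> x * h x) \<le> norm (c * indicator \<Omega> x :: real)"
      by (intro always_eventually) (auto simp: indicator_def intro: order_trans[OF that(2) abs_ge_self])
  qed measurable
  have w_int: "integrable lborel (w j)" for j
  proof -
    have "(\<lambda>x. indicator \<Omega> x * w j x) = w j"
      using energy_spaceD(2)[OF u] by (intro ext) (auto simp: w_def indicator_def)
    then show ?thesis using bdd_int[of "w j" M] bdw by simp
  qed
  define err where "err m j = (LINT x|lborel. indicator \<Omega> x * \<bar>w j x - cell_average m (w j) x\<bar>)" for m j
  have err_small: "\<exists>m. \<forall>j. err m j < e" if e: "e > 0" for e
  proof -
    define \<mu> where "\<mu> = measure lborel \<Omega>"
    have \<mu>: "0 \<le> \<mu>" by (simp add: \<mu>_def)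
    define \<eta> where "\<eta> = e / (2 * (\<mu> + 1))"
    have \<eta>: "\<eta> > 0" using e \<mu> by (simp add: \<eta>_def)
    define K where "K m = (real CARD('n) / real (Suc m)) powr (real CARD('n) + 2 * s) / (1 / real (Suc m)) ^ CARD('n)" for m
    have K_eq: "K m = real CARD('n) powr (real CARD('n) + 2 * s) * inverse (real (Suc m)) powr (2 * s)" for m
    proof -
      have "K m = (real CARD('n) * inverse (real (Suc m))) powr (real CARD('n) + 2 * s) / inverse (real (Suc m)) powr real CARD('n)"
        by (simp add: K_def powr_realpow divide_inverse)
      also have "\<dots> = real CARD('n) powr (real CARD('n) + 2 * s) * (inverse (real (Suc m)) powr (real CARD('n) + 2 * s) / inverse (real (Suc m)) powr real CARD('n))"
        by (simp only: powr_mult) simp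
      also have "inverse (real (Suc m)) powr (real CARD('n) + 2 * s) / inverse (real (Suc m)) powr real CARD('n) = inverse (real (Suc m)) powr (2 * s)"
        by (simp only: powr_diff[symmetric]) simp
      finally show ?thesis .
    qed
    have "(\<lambda>m. inverse (real (Suc m)) powr (2 * s)) \<longlonglongrightarrow> 0 powr (2 * s)"
      by (rule tendsto_powr'[OF LIMSEQ_inverse_real_of_nat tendsto_const]) (use s in auto)
    then have "(\<lambda>m. K m / \<eta> * C) \<longlonglongrightarrow> real CARD('n) powr (real CARD('n) + 2 * s) * 0 / \<eta> * C"
      unfolding K_eq by (intro tendsto_intros) (use \<eta> in auto)
    then have "(\<lambda>m. K m / \<eta> * C) \<longlonglongrightarrow> 0" by simp
    from order_tendstoD(2)[OF this, of "e / 2"] obtain m where m: "K m / \<eta> * C < e / 2"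
      using e by (auto simp: eventually_sequentially)
    have "err m j < e" for j
    proof -
      have "err m j \<le> \<eta> * \<mu> + K m / \<eta> * energy s (w j) (w j)"
        unfolding err_def \<mu>_def K_def
        by (rule cell_average_error[OF s]) (use u bdw \<eta> \<Omega> in \<open>auto simp: w_def\<close>)
      also have "K m / \<eta> * energy s (w j) (w j) \<le> K m / \<eta> * C"
        using C \<eta> by (intro mult_left_mono) (auto simp: w_def K_def)
      also have "\<eta> * \<mu> \<le> e / 2"
        using e \<mu> by (simp add: \<eta>_def field_simps)
      finally show ?thesis using m by linarith
    qed
    then show ?thesis by blast
  qed
  have cauchy: "\<exists>N. \<forall>i\<ge>N. \<forall>j\<ge>N. (LINT x|lborel. norm (w i x - w j x)) < e" if e: "e > 0" for e
  proof -
    obtain m where m: "\<And>j. err m j < e / 4" using err_small[of "e / 4"] e by auto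
    define A where "A j = cell_average m (w j)" for j
    have [measurable]: "A j \<in> borel_measurable borel" for j by (simp add: A_def)
    have bdA: "\<bar>A j x\<bar> \<le> M" for j x
      unfolding A_def using cell_average_bound[of "w j" M] bdw by auto
    define L where "L x = lim (\<lambda>j. A j x)" for x
    have AL: "(\<lambda>j. A j x) \<longlonglongrightarrow> L x" for x
      using conv[of m x] by (simp add: L_def A_def w_def convergent_LIMSEQ_iff)
    have [measurable]: "L \<in> borel_measurable borel"
      by (rule borel_measurable_LIMSEQ_real[OF AL]) simp
    have bdL: "\<bar>L x\<bar> \<le> M" for x
      by (rule Lim_bounded[OF tendsto_rabs[OF AL]]) (use bdA in auto)
    define a where "a j = (LINT x|lborel. indicator \<Omega> x * \<bar>A j x - L x\<bar>)" for j
    have "a \<longlonglongrightarrow> (LINT x|lborel. indicator \<Omega> x * 0)"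
      unfolding a_def
    proof (rule integral_dominated_convergence[OF _ _ i\<Omega>[of "2 * M"]])
      show "AE x in lborel. (\<lambda>j. indicator \<Omega> x * \<bar>A j x - L x\<bar>) \<longlonglongrightarrow> indicator \<Omega> x * 0"
      proof (intro always_eventually allI tendsto_mult tendsto_const)
        fix x show "(\<lambda>j. \<bar>A j x - L x\<bar>) \<longlonglongrightarrow> 0"
          using tendsto_rabs[OF tendsto_diff[OF AL[of x] tendsto_const[of "L x"]]] by simp
      qed
      fix j
      have "\<bar>A j x - L x\<bar> \<le> 2 * M" for x using bdA[of j x] bdL[of x] by linarith
      then show "AE x in lborel. norm (indicator \<Omega> x * \<bar>A j x - L x\<bar>) \<le> 2 * M * indicator \<Omega> x"
        by (intro always_eventually) (auto simp: indicator_def)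
    qed measurable
    then have "a \<longlonglongrightarrow> 0" by simp
    from order_tendstoD(2)[OF this, of "e / 4"] obtain N where N: "\<And>j. j \<ge> N \<Longrightarrow> a j < e / 4"
      using e by (auto simp: eventually_sequentially)
    have "(LINT x|lborel. norm (w i x - w j x)) < e" if ij: "i \<ge> N" "j \<ge> N" for i j
    proof -
      have i1: "integrable lborel (\<lambda>x. indicator \<Omega> x * \<bar>w j x - A j x\<bar>)" for j
      proof (rule bdd_int)
        show "\<bar>\<bar>w j x - A j x\<bar>\<bar> \<le> 2 * M" for x using bdw[of j x] bdA[of j x] by linarith
      qed simp
      have i2: "integrable lborel (\<lambda>x. indicator \<Omega> x * \<bar>A j x - L x\<bar>)" for j
      proof (rule bdd_int)
        show "\<bar>\<bar>A j x - L x\<bar>\<bar> \<le> 2 * M" for x using bdA[of j x] bdL[of x] by linarith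
      qed simp
      have "(LINT x|lborel. norm (w i x - w j x))
        \<le> (LINT x|lborel. (indicator \<Omega> x * \<bar>w i x - A i x\<bar> + indicator \<Omega> x * \<bar>w j x - A j x\<bar>)
            + (indicator \<Omega> x * \<bar>A i x - L x\<bar> + indicator \<Omega> x * \<bar>A j x - L x\<bar>))"
      proof (rule integral_mono)
        show "norm (w i x - w j x) \<le> (indicator \<Omega> x * \<bar>w i x - A i x\<bar> + indicator \<Omega> x * \<bar>w j x - A j x\<bar>)
            + (indicator \<Omega> x * \<bar>A i x - L x\<bar> + indicator \<Omega> x * \<bar>A j x - L x\<bar>)" for x
          using energy_spaceD(2)[OF u] by (cases "x \<in> \<Omega>") (auto simp: w_def)
      qed (use w_int i1 i2 in auto)
      also have "\<dots> = (err m i + err m j) + (a i + a j)"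
        using i1 i2 by (simp add: err_def a_def A_def)
      also have "\<dots> < e" using m[of i] m[of j] N[OF ij(1)] N[OF ij(2)] by linarith
      finally show ?thesis .
    qed
    then show ?thesis by blast
  qed
  obtain r2 where r2: "strict_mono r2" "AE x in lborel. Cauchy (\<lambda>i. w (r2 i) x)"
    using cauchy_L1_AE_cauchy_subseq[OF w_int cauchy] by blast
  show ?thesis
  proof (rule that[of "r1 \<circ> r2"])
    show "strict_mono (r1 \<circ> r2)" using r1 r2(1) by (rule strict_mono_o)
    show "AE x in lborel. convergent (\<lambda>j. u ((r1 \<circ> r2) j) x)"
      using r2(2) by eventually_elim (simp add: w_def Cauchy_convergent_iff)
  qed
qed

section \<open>Truncation gain and lower semicontinuity\<close>

text \<open>
  Square integrability suffices because \<open>u\<close> lives on a set of finite measure.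
\<close>
lemma energy_space_integrable:
  fixes u :: "real ^ 'n \<Rightarrow> real"
  assumes u: "u \<in> energy_space s \<Omega>" and \<Omega>: "\<Omega> \<in> sets borel" "emeasure lborel \<Omega> < \<infinity>"
  shows "integrable lborel u"
proof (rule Bochner_Integration.integrable_bound)
  note [measurable] = energy_spaceD(1)[OF u]
  show "integrable lborel (\<lambda>x. indicator \<Omega> x + (u x)\<^sup>2 :: real)"
    using \<Omega> energy_spaceD(3)[OF u] by (intro Bochner_Integration.integrable_add integrable_real_indicator) auto
  have "\<bar>a\<bar> \<le> 1 + a\<^sup>2" for a :: real
  proof -
    have "0 \<le> (\<bar>a\<bar> - 1)\<^sup>2" "0 \<le> \<bar>a\<bar>" by simp_all
    then show ?thesis by (simp add: power2_diff)
  qed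
  then show "AE x in lborel. norm (u x) \<le> norm (indicator \<Omega> x + (u x)\<^sup>2 :: real)"
    using energy_spaceD(2)[OF u] by (intro always_eventually) (auto simp: indicator_def)
qed (use energy_spaceD(1)[OF u] in simp)

text \<open>
  Truncation never increases differences. In addition, if \<open>w x > M\<close> and \<open>y\<close> lies in a ball
  outside \<Omega>, then \<open>w y = 0\<close>, and the squared difference drops from \<open>(w x)\<^sup>2\<close> to \<open>M\<^sup>2\<close>, that is
  by at least \<open>2 * M * (w x - M)\<close>. As \<Omega> is bounded, the kernel is bounded below on such pairs.
\<close>
lemma energy_clamp_gain:
  fixes \<Omega> :: "(real ^ 'n) set"
  assumes s: "0 < s" and \<Omega>: "\<Omega> \<in> sets borel" "bounded \<Omega>"
  obtains \<kappa> where "0 < \<kappa>"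
    "\<And>M w. \<lbrakk>0 \<le> M; w \<in> energy_space s \<Omega>\<rbrakk> \<Longrightarrow>
       energy s (\<lambda>x. min (max (w x) 0) M) (\<lambda>x. min (max (w x) 0) M)
         + 2 * M * \<kappa> * (LINT x|lborel. max (w x - M) 0) \<le> energy s w w"
proof -
  obtain R where R: "0 < R" "\<And>x. x \<in> \<Omega> \<Longrightarrow> norm x \<le> R"
    using \<Omega>(2) by (auto simp: bounded_pos)
  define c where "c = (R + 1) *\<^sub>R (axis undefined 1 :: real ^ 'n)"
  define B where "B = ball c 1"
  define d where "d = real CARD('n) + 2 * s"
  define \<rho> where "\<rho> = 2 * R + 2"
  have nc: "norm c = R + 1" using R(1) by (simp add: c_def)
  have [measurable]: "B \<in> sets borel" by (simp add: B_def)
  have B: "R < norm y \<and> norm y \<le> R + 2" if "y \<in> B" for y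
  proof -
    have "norm (c - y) < 1" using that by (simp add: B_def dist_norm)
    then show ?thesis
      using nc norm_triangle_ineq2[of c y] norm_triangle_ineq2[of y c] by (simp add: norm_minus_commute)
  qed
  have \<rho>: "0 < \<rho> powr d" using R(1) by (simp add: \<rho>_def)
  define \<omega> where "\<omega> = measure lborel B"
  have \<omega>: "0 < \<omega>" by (simp add: \<omega>_def B_def)
  have emB: "emeasure lborel B = ennreal \<omega>"
    unfolding \<omega>_def using emeasure_lborel_ball_finite[of c 1]
    by (intro emeasure_eq_ennreal_measure) (simp add: B_def)
  have fin: "emeasure lborel \<Omega> < \<infinity>" by (rule emeasure_bounded_finite[OF \<Omega>(2)])
  show ?thesis
  proof (rule that[of "\<omega> / \<rho> powr d"])
    show "0 < \<omega> / \<rho> powr d" using \<omega> \<rho> by simp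
    fix M :: real and w :: "real ^ 'n \<Rightarrow> real"
    assume M: "0 \<le> M" and w: "w \<in> energy_space s \<Omega>"
    note [measurable] = energy_spaceD(1)[OF w]
    define wc where "wc x = min (max (w x) 0) M" for x
    have wc: "wc \<in> energy_space s \<Omega>" unfolding wc_def by (rule energy_space_clamp[OF w M])
    note [measurable] = energy_spaceD(1)[OF wc]
    define e where "e x = max (w x - M) 0" for x
    have [measurable]: "e \<in> borel_measurable borel" unfolding e_def by measurable
    have e: "0 \<le> e x" for x by (simp add: e_def)
    have ie: "integrable lborel e"
    proof (rule Bochner_Integration.integrable_bound[OF energy_space_integrable[OF w \<Omega>(1) fin]])
      show "AE x in lborel. norm (e x) \<le> norm (w x)"
        using M by (intro always_eventually) (auto simp: e_def)
    qed measurable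
    have pt: "gagliardo_integrand s wc wc (x, y) + 2 * M / \<rho> powr d * (e x * indicator B y)
        \<le> gagliardo_integrand s w w (x, y)" for x y
    proof (cases "y \<in> B \<and> M < w x")
      case False
      then have 0: "e x * indicator B y = 0" by (auto simp: e_def indicator_def)
      have "\<bar>wc x - wc y\<bar> \<le> \<bar>w x - w y\<bar>" by (auto simp: wc_def)
      then have "(wc x - wc y)\<^sup>2 \<le> (w x - w y)\<^sup>2" by (rule abs_le_square_iff[THEN iffD1])
      then have "gagliardo_integrand s wc wc (x, y) \<le> gagliardo_integrand s w w (x, y)"
        unfolding gagliardo_integrand_eq by (intro divide_right_mono) (auto simp: power2_eq_square)
      then show ?thesis unfolding 0 by simp
    next
      case True
      then have x: "x \<in> \<Omega>" using M energy_spaceD(2)[OF w, of x] by auto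
      have y: "y \<notin> \<Omega>" using True B[of y] R(2)[of y] by auto
      have wy: "w y = 0" "wc y = 0" "wc x = M" "e x = w x - M"
        using energy_spaceD(2)[OF w y] M True by (auto simp: wc_def e_def)
      have "x \<noteq> y" using x y by auto
      then have 0: "0 < norm (x - y) powr d" by simp
      have "norm (x - y) \<le> norm x + norm y" by (rule norm_triangle_ineq4)
      also have "\<dots> \<le> \<rho>" using R(2)[OF x] B[of y] True by (simp add: \<rho>_def)
      finally have "norm (x - y) powr d \<le> \<rho> powr d"
        using s by (intro powr_mono2) (auto simp: d_def)
      then have "2 * M * (w x - M) / \<rho> powr d \<le> 2 * M * (w x - M) / norm (x - y) powr d"
        using M True by (intro divide_left_mono mult_pos_pos[OF \<rho> 0]) auto
      moreover have "(M * M + 2 * M * (w x - M)) / norm (x - y) powr d \<le> w x * w x / norm (x - y) powr d"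
      proof (rule divide_right_mono)
        \<comment> \<open>The excess term is \<open>(w x)\<^sup>2 - M\<^sup>2 - 2 * M * (w x - M) = (w x - M)\<^sup>2\<close>.\<close>
      have "0 \<le> (w x - M)\<^sup>2" by simp
        then show "M * M + 2 * M * (w x - M) \<le> w x * w x"
          by (simp add: power2_eq_square algebra_simps)
      qed simp
      ultimately show ?thesis
        using True by (simp add: gagliardo_integrand_eq wy add_divide_distrib flip: d_def)
    qed
    have "ennreal (energy s wc wc) + ennreal (2 * M / \<rho> powr d) * (ennreal (LINT x|lborel. e x) * ennreal \<omega>)
      = (\<integral>\<^sup>+ z. ennreal (gagliardo_integrand s wc wc z) \<partial>lborel)
        + ennreal (2 * M / \<rho> powr d) * (\<integral>\<^sup>+ z. ennreal (e (fst z)) * indicator B (snd z) \<partial>lborel)"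
    proof -
      have m: "(\<lambda>z. ennreal (e (fst z)) * indicator B (snd z)) \<in> borel_measurable (borel \<Otimes>\<^sub>M borel)"
        by measurable
      have "(\<integral>\<^sup>+ z. ennreal (e (fst z)) * indicator B (snd z) \<partial>lborel)
          = (\<integral>\<^sup>+ x. ennreal (e x) * ennreal \<omega> \<partial>lborel)"
        by (subst nn_integral_pair_lborel(1)) (use m in \<open>auto simp: borel_prod nn_integral_cmult_indicator emB\<close>)
      also have "\<dots> = ennreal (LINT x|lborel. e x) * ennreal \<omega>"
        by (subst nn_integral_multc) (auto simp: nn_integral_eq_integral[OF ie] e)
      finally show ?thesis
        by (simp add: energy_ennreal[OF energy_spaceD(4)[OF wc]])
    qed
    also have "\<dots> = (\<integral>\<^sup>+ z. ennreal (gagliardo_integrand s wc wc z)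
        + ennreal (2 * M / \<rho> powr d) * (ennreal (e (fst z)) * indicator B (snd z)) \<partial>lborel)"
    proof -
      have "(\<lambda>z. ennreal (e (fst z)) * indicator B (snd z)) \<in> borel_measurable (borel \<Otimes>\<^sub>M borel)"
        by measurable
      then show ?thesis by (simp add: nn_integral_add nn_integral_cmult borel_prod)
    qed
    also have "\<dots> \<le> (\<integral>\<^sup>+ z. ennreal (gagliardo_integrand s w w z) \<partial>lborel)"
    proof (rule nn_integral_mono)
      fix z :: "(real ^ 'n) \<times> (real ^ 'n)"
      obtain x y where z: "z = (x, y)" by (cases z)
      have "ennreal (gagliardo_integrand s wc wc z) + ennreal (2 * M / \<rho> powr d) * (ennreal (e (fst z)) * indicator B (snd z))
         = ennreal (gagliardo_integrand s wc wc z) + ennreal (2 * M / \<rho> powr d * (e (fst z) * indicator B (snd z)))"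
        using M \<rho> e by (cases "snd z \<in> B") (simp_all flip: ennreal_mult)
      also have "\<dots> = ennreal (gagliardo_integrand s wc wc z + 2 * M / \<rho> powr d * (e (fst z) * indicator B (snd z)))"
        using M \<rho> e by (subst ennreal_plus) (auto simp: gagliardo_integrand_nonneg)
      also have "\<dots> \<le> ennreal (gagliardo_integrand s w w z)"
        unfolding z fst_conv snd_conv by (rule ennreal_leI[OF pt])
      finally show "ennreal (gagliardo_integrand s wc wc z) + ennreal (2 * M / \<rho> powr d) * (ennreal (e (fst z)) * indicator B (snd z))
        \<le> ennreal (gagliardo_integrand s w w z)" .
    qed
    also have "\<dots> = ennreal (energy s w w)" by (rule energy_ennreal[OF energy_spaceD(4)[OF w]])
    also have "ennreal (energy s wc wc) + ennreal (2 * M / \<rho> powr d) * (ennreal (LINT x|lborel. e x) * ennreal \<omega>)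
      = ennreal (energy s wc wc + 2 * M * (\<omega> / \<rho> powr d) * (LINT x|lborel. e x))"
    proof -
      have "0 \<le> (LINT x|lborel. e x)" using e by (intro Bochner_Integration.integral_nonneg) simp
      then have "ennreal (2 * M / \<rho> powr d) * (ennreal (LINT x|lborel. e x) * ennreal \<omega>)
         = ennreal (2 * M * (\<omega> / \<rho> powr d) * (LINT x|lborel. e x))"
        using M \<rho> \<omega> by (simp add: mult_ac flip: ennreal_mult)
      then show ?thesis
        using \<open>0 \<le> (LINT x|lborel. e x)\<close> M \<rho> \<omega> energy_self_nonneg[of s wc] by (simp add: ennreal_plus)
    qed
    finally have "energy s wc wc + 2 * M * (\<omega> / \<rho> powr d) * (LINT x|lborel. e x) \<le> energy s w w"
      by (subst (asm) ennreal_le_iff) (rule energy_self_nonneg)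
    then show "energy s (\<lambda>x. min (max (w x) 0) M) (\<lambda>x. min (max (w x) 0) M)
         + 2 * M * (\<omega> / \<rho> powr d) * (LINT x|lborel. max (w x - M) 0) \<le> energy s w w"
      by (simp add: wc_def[abs_def] e_def[abs_def])
  qed
qed

text \<open>
  Almost everywhere convergence of the functions carries over to the Gagliardo integrands, so
  Fatou's lemma replaces weak compactness.
\<close>
lemma energy_fatou:
  fixes w :: "nat \<Rightarrow> real ^ 'n \<Rightarrow> real"
  assumes w: "\<And>j. w j \<in> energy_space s \<Omega>" and [measurable]: "u \<in> borel_measurable borel"
    and lim: "AE x in lborel. (\<lambda>j. w j x) \<longlonglongrightarrow> u x"
    and e: "(\<lambda>j. energy s (w j) (w j)) \<longlonglongrightarrow> e"
  shows "integrable lborel (gagliardo_integrand s u u)" and "energy s u u \<le> e"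
proof -
  have [measurable]: "w j \<in> borel_measurable borel" for j by (rule energy_spaceD(1)[OF w])
  have e0: "0 \<le> e" using LIMSEQ_le_const[OF e] energy_self_nonneg by blast
  have "AE z in lborel. (\<lambda>j. gagliardo_integrand s (w j) (w j) z) \<longlonglongrightarrow> gagliardo_integrand s u u z"
    using AE_lborel_pair[OF lim]
  proof eventually_elim
    case (elim z)
    then show ?case
      by (cases z) (auto simp: gagliardo_integrand_eq divide_inverse intro!: tendsto_intros)
  qed
  then have l: "AE z in lborel. ennreal (gagliardo_integrand s u u z)
      = liminf (\<lambda>j. ennreal (gagliardo_integrand s (w j) (w j) z))"
    by eventually_elim (rule lim_imp_Liminf[symmetric], auto intro: tendsto_ennrealI)
  have "(\<integral>\<^sup>+ z. ennreal (gagliardo_integrand s u u z) \<partial>lborel)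
     = (\<integral>\<^sup>+ z. liminf (\<lambda>j. ennreal (gagliardo_integrand s (w j) (w j) z)) \<partial>lborel)"
    by (rule nn_integral_cong_AE[OF l])
  also have "\<dots> \<le> liminf (\<lambda>j. \<integral>\<^sup>+ z. ennreal (gagliardo_integrand s (w j) (w j) z) \<partial>lborel)"
    by (rule nn_integral_liminf) simp
  also have "\<dots> = liminf (\<lambda>j. ennreal (energy s (w j) (w j)))"
    by (simp add: energy_ennreal[OF energy_spaceD(4)[OF w]])
  also have "\<dots> = ennreal e"
    by (rule lim_imp_Liminf) (auto intro: tendsto_ennrealI[OF e])
  finally have le: "(\<integral>\<^sup>+ z. ennreal (gagliardo_integrand s u u z) \<partial>lborel) \<le> ennreal e" .
  then show i: "integrable lborel (gagliardo_integrand s u u)"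
    by (intro integrableI_nonneg) (auto simp: gagliardo_integrand_nonneg intro: le_less_trans)
  show "energy s u u \<le> e"
    using le e0 unfolding energy_ennreal[OF i] by simp
qed

section \<open>Minimisation under an upper barrier\<close>

text \<open>
  The problem with right-hand side \<open>lam * t powr (r - 1) + b t\<close>, where the regular part \<open>b\<close> is
  constant above the barrier \<open>M\<close> and \<open>B\<close> is its primitive. The last two assumptions together
  say that the constant \<open>M\<close> acts as a supersolution.
\<close>
locale singular_problem =
  fixes s r lam M \<beta> \<kappa> :: real and b B :: "real \<Rightarrow> real" and \<Omega> :: "(real ^ 'n) set"
  assumes s: "0 < s" "s < 1" and r: "0 < r" "r < 1" and lam: "0 < lam" and M: "0 < M"
    and \<Omega>: "open \<Omega>" "bounded \<Omega>"
    and b_nonneg: "0 \<le> b t" and b_le: "b t \<le> \<beta>" and b_const: "M \<le> t \<Longrightarrow> b t = b M"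
    and b_meas [measurable]: "b \<in> borel_measurable borel"
    and B_deriv: "(B has_real_derivative b t) (at t)" and B_0: "B 0 = 0"
    and clamp_gain: "w \<in> energy_space s \<Omega> \<Longrightarrow>
       energy s (\<lambda>x. min (max (w x) 0) M) (\<lambda>x. min (max (w x) 0) M)
         + 2 * M * \<kappa> * (LINT x|lborel. max (w x - M) 0) \<le> energy s w w"
    and supersolution: "lam * M powr (r - 1) + b M \<le> M * \<kappa>"
begin

definition h :: "real \<Rightarrow> real" where
  "h t = lam * t powr (r - 1) + b t"

definition F :: "real \<Rightarrow> real" where
  "F t = lam / r * max t 0 powr r + B (max t 0)"

definition J :: "(real ^ 'n \<Rightarrow> real) \<Rightarrow> real" where
  "J w = energy s w w / 2 - (LINT x|lborel. F (w x))"

lemma \<Omega>_measurable [measurable]: "\<Omega> \<in> sets borel"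
  using \<Omega>(1) by simp

lemma \<Omega>_finite: "emeasure lborel \<Omega> < \<infinity>"
  by (rule emeasure_bounded_finite[OF \<Omega>(2)])

lemma integrable_\<Omega>: "integrable lborel (\<lambda>x. c * indicator \<Omega> x :: real)"
  using \<Omega>_finite by (intro integrable_mult_right integrable_real_indicator) auto

lemma \<beta>_nonneg: "0 \<le> \<beta>"
  using b_nonneg[of 0] b_le[of 0] by linarith

lemma h_nonneg: "0 \<le> h t"
  using lam b_nonneg by (simp add: h_def)

lemma h_measurable [measurable]: "h \<in> borel_measurable borel"
  unfolding h_def by measurable

lemma F_deriv: "0 < t \<Longrightarrow> (F has_real_derivative h t) (at t)"
proof -
  assume t: "0 < t"
  have "((\<lambda>t. lam / r * t powr r + B t) has_real_derivative h t) (at t)"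
    unfolding h_def using t r by (auto intro!: derivative_eq_intros B_deriv)
  then show ?thesis
    by (rule has_field_derivative_transform_within[where d = t]) (use t in \<open>auto simp: F_def dist_real_def\<close>)
qed

lemma F_nonpos: "t \<le> 0 \<Longrightarrow> F t = 0"
  by (simp add: F_def B_0 max_def)

lemma B_mono: "a \<le> c \<Longrightarrow> B a \<le> B c"
  by (rule DERIV_nonneg_imp_nondecreasing) (use B_deriv b_nonneg in blast)+

lemma F_mono: "a \<le> c \<Longrightarrow> F a \<le> F c"
  unfolding F_def using lam r B_mono
  by (intro add_mono mult_left_mono powr_mono2) auto

lemma F_nonneg: "0 \<le> F t"
  using F_mono[of "min t 0" t] F_nonpos[of "min t 0"] by simp

lemma F_ge_power: "0 \<le> t \<Longrightarrow> lam / r * t powr r \<le> F t"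
  using B_mono[of 0 t] by (simp add: F_def B_0)

lemma F_continuous: "continuous_on UNIV F"
proof -
  have "continuous_on UNIV B"
    using B_deriv by (meson DERIV_continuous continuous_at_imp_continuous_on)
  then have "continuous_on UNIV (\<lambda>t. B (max t 0))"
    by (rule continuous_on_compose2) (auto intro!: continuous_intros)
  moreover have "continuous_on UNIV (\<lambda>t::real. max t 0 powr r)"
    by (rule continuous_on_powr') (use r in \<open>auto intro!: continuous_intros\<close>)
  ultimately show ?thesis
    unfolding F_def by (intro continuous_on_add continuous_on_mult continuous_on_const)
qed

lemma F_measurable [measurable]: "F \<in> borel_measurable borel"
  using F_continuous by (rule borel_measurable_continuous_onI)

lemma F_growth: "F t \<le> (lam / r + \<beta>) * (1 + \<bar>t\<bar>)"
proof (cases "t \<le> 0")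
  case True
  then show ?thesis using lam r \<beta>_nonneg by (simp add: F_nonpos)
next
  case False
  then have t: "0 < t" by simp
  have "t powr r \<le> 1 + t"
  proof (cases "t \<le> 1")
    case True
    then have "t powr r \<le> 1 powr r" using t r by (intro powr_mono2) auto
    then show ?thesis using t by simp
  next
    case False
    then have "t powr r \<le> t powr 1" using r by (intro powr_mono) auto
    then show ?thesis using t by simp
  qed
  then have 1: "lam / r * t powr r \<le> lam / r * (1 + t)"
    using lam r by (intro mult_left_mono) auto
  obtain z where "B t - B 0 = (t - 0) * b z"
    using MVT2[OF t, of B b] B_deriv by auto
  then have "B t \<le> t * \<beta>"
    using b_le[of z] t by (simp add: B_0)
  then have "B t \<le> \<beta> * (1 + t)" using \<beta>_nonneg by (simp add: algebra_simps)
  with 1 t show ?thesis by (simp add: F_def algebra_simps)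
qed

text \<open>
  Above \<open>M\<close> the slope \<open>h\<close> of \<open>F\<close> is at most \<open>h M\<close>, since the singular power decreases and \<open>b\<close>
  is constant there.
\<close>
lemma F_above: "M \<le> t \<Longrightarrow> F t \<le> F M + h M * (t - M)"
proof (cases "t = M")
  assume "M \<le> t" "t \<noteq> M"
  then have t: "M < t" by simp
  obtain z where z: "M < z" "z < t" "F t - F M = (t - M) * h z"
    using MVT2[OF t, of F h] F_deriv M by auto
  have "z powr (r - 1) \<le> M powr (r - 1)"
    using z M r by (intro powr_mono2') auto
  then have "h z \<le> h M"
    using lam z b_const[of z] by (simp add: h_def)
  then have "(t - M) * h z \<le> (t - M) * h M"
    using t by (intro mult_left_mono) auto
  with z(3) show ?thesis by (simp add: mult.commute)
qed simp

lemma F_composition_integrable: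
  assumes w: "w \<in> energy_space s \<Omega>"
  shows "integrable lborel (\<lambda>x. F (w x))"
proof (rule Bochner_Integration.integrable_bound)
  note [measurable] = energy_spaceD(1)[OF w]
  show "(\<lambda>x. F (w x)) \<in> borel_measurable lborel" by measurable
  have "integrable lborel (\<lambda>x. 1 * indicator \<Omega> x + \<bar>w x\<bar>)"
    using integrable_\<Omega>[of 1] energy_space_integrable[OF w \<Omega>_measurable \<Omega>_finite]
    by (intro Bochner_Integration.integrable_add integrable_abs)
  then show "integrable lborel (\<lambda>x. (lam / r + \<beta>) * (1 * indicator \<Omega> x + \<bar>w x\<bar>))"
    by (rule integrable_mult_right)
  show "AE x in lborel. norm (F (w x)) \<le> norm ((lam / r + \<beta>) * (1 * indicator \<Omega> x + \<bar>w x\<bar>))"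
  proof (intro always_eventually allI)
    fix x
    have "F (w x) \<le> (lam / r + \<beta>) * (1 * indicator \<Omega> x + \<bar>w x\<bar>)"
      using F_growth[of "w x"] energy_spaceD(2)[OF w, of x]
      by (cases "x \<in> \<Omega>") (auto simp: F_nonpos)
    then show "norm (F (w x)) \<le> norm ((lam / r + \<beta>) * (1 * indicator \<Omega> x + \<bar>w x\<bar>))"
      using F_nonneg[of "w x"] by simp
  qed
qed

definition obstacle_class :: "(real ^ 'n \<Rightarrow> real) set" where
  "obstacle_class = {w \<in> energy_space s \<Omega>. \<forall>x. 0 \<le> w x \<and> w x \<le> M}"

lemma clamp_in_obstacle_class:
  "w \<in> energy_space s \<Omega> \<Longrightarrow> (\<lambda>x. min (max (w x) 0) M) \<in> obstacle_class"
  using energy_space_clamp[of w s \<Omega> M] M by (auto simp: obstacle_class_def)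

text \<open>
  What \<open>F\<close> loses by truncation is at most \<open>h M\<close> times the integral of the excess over \<open>M\<close>; by
  the supersolution assumption the gain in energy outweighs it.
\<close>
lemma J_clamp_le:
  assumes w: "w \<in> energy_space s \<Omega>"
  shows "J (\<lambda>x. min (max (w x) 0) M) \<le> J w"
proof -
  note [measurable] = energy_spaceD(1)[OF w]
  let ?wc = "\<lambda>x. min (max (w x) 0) M"
  have wc: "?wc \<in> energy_space s \<Omega>" using energy_space_clamp[OF w] M by simp
  have ie: "integrable lborel (\<lambda>x. max (w x - M) 0)"
  proof (rule Bochner_Integration.integrable_bound[OF energy_space_integrable[OF w \<Omega>_measurable \<Omega>_finite]])
    show "AE x in lborel. norm (max (w x - M) 0) \<le> norm (w x)"
      using M by (intro always_eventually) auto
  qed measurable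
  have e0: "0 \<le> (LINT x|lborel. max (w x - M) 0)"
    by (rule Bochner_Integration.integral_nonneg) simp
  have "(LINT x|lborel. F (w x)) \<le> (LINT x|lborel. F (?wc x) + h M * max (w x - M) 0)"
  proof (rule integral_mono)
    show "F (w x) \<le> F (?wc x) + h M * max (w x - M) 0" for x
      using F_above[of "w x"] M by (auto simp: F_nonpos max_def min_def)
  qed (use F_composition_integrable[OF w] F_composition_integrable[OF wc] ie in auto)
  also have "\<dots> = (LINT x|lborel. F (?wc x)) + h M * (LINT x|lborel. max (w x - M) 0)"
    using F_composition_integrable[OF wc] ie by simp
  also have "h M * (LINT x|lborel. max (w x - M) 0) \<le> M * \<kappa> * (LINT x|lborel. max (w x - M) 0)"
    using supersolution e0 by (intro mult_right_mono) (auto simp: h_def)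
  finally show ?thesis
    using clamp_gain[OF w] by (simp add: J_def)
qed

text \<open>
  The direct method in the class of functions with values in \<open>[0, M]\<close>, where \<open>F\<close> is bounded.
  Truncation extends minimality to the whole energy space.
\<close>
lemma J_minimizer_exists:
  obtains u where "u \<in> obstacle_class" "\<And>w. w \<in> energy_space s \<Omega> \<Longrightarrow> J u \<le> J w"
proof -
  define c where "c = (lam / r + \<beta>) * (1 + M)"
  have c: "0 \<le> c" using lam r M \<beta>_nonneg by (simp add: c_def)
  have F_c: "norm (F (w x)) \<le> c * indicator \<Omega> x" if "w \<in> obstacle_class" for w x
  proof -
    have w: "w \<in> energy_space s \<Omega>" "0 \<le> w x" "w x \<le> M" using that by (auto simp: obstacle_class_def)
    have "F (w x) \<le> F M" using w F_mono by simp
    also have "F M \<le> c" using F_growth[of M] M by (simp add: c_def)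
    finally show ?thesis
      using energy_spaceD(2)[OF w(1), of x] F_nonneg[of "w x"]
      by (cases "x \<in> \<Omega>") (auto simp: F_nonpos)
  qed
  define D where "D = c * measure lborel \<Omega>"
  have IF: "(LINT x|lborel. F (w x)) \<le> D" if "w \<in> obstacle_class" for w
  proof -
    have "(LINT x|lborel. F (w x)) \<le> (LINT x|lborel. c * indicator \<Omega> x)"
      using F_c[OF that] that
      by (intro integral_mono F_composition_integrable integrable_\<Omega>)
         (auto simp: obstacle_class_def intro: order_trans[OF abs_ge_self])
    then show ?thesis by (simp add: D_def)
  qed
  have z: "(\<lambda>_. 0) \<in> obstacle_class"
    using M by (simp add: obstacle_class_def energy_space_zero)
  define m where "m = Inf (J ` obstacle_class)"
  have bdd: "bdd_below (J ` obstacle_class)"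
  proof (rule bdd_belowI2)
    fix w assume "w \<in> obstacle_class"
    then show "- D \<le> J w"
      using IF[of w] energy_self_nonneg[of s w] by (simp add: J_def)
  qed
  have m_le: "m \<le> J w" if "w \<in> obstacle_class" for w
    unfolding m_def using bdd that by (auto intro: cInf_lower)
  have "\<exists>w\<in>obstacle_class. J w < m + 1 / real (Suc j)" for j
  proof -
    have "m < m + 1 / real (Suc j)" by simp
    then show ?thesis
      unfolding m_def using z bdd by (subst (asm) cInf_less_iff) auto
  qed
  then obtain w where w: "\<And>j. w j \<in> obstacle_class" "\<And>j. J (w j) < m + 1 / real (Suc j)"
    by metis
  have wE: "w j \<in> energy_space s \<Omega>" "0 \<le> w j x" "w j x \<le> M" for j x
    using w(1)[of j] by (auto simp: obstacle_class_def)
  have "(\<lambda>j. m + 1 / real (Suc j)) \<longlonglongrightarrow> m + 0"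
    using LIMSEQ_inverse_real_of_nat by (intro tendsto_intros) (simp add: divide_inverse)
  then have lim_m: "(\<lambda>j. m + 1 / real (Suc j)) \<longlonglongrightarrow> m" by simp
  have Jw: "(\<lambda>j. J (w j)) \<longlonglongrightarrow> m"
  proof (rule tendsto_sandwich[OF _ _ tendsto_const lim_m])
    show "\<forall>\<^sub>F j in sequentially. m \<le> J (w j)"
      using m_le[OF w(1)] by simp
    show "\<forall>\<^sub>F j in sequentially. J (w j) \<le> m + 1 / real (Suc j)"
      using w(2) by (intro always_eventually allI less_imp_le)
  qed
  have Ebound: "energy s (w j) (w j) \<le> 2 * (m + 1 + D)" for j
  proof -
    have "1 / real (Suc j) \<le> 1" by simp
    then have "m + 1 / real (Suc j) \<le> m + 1" by (rule add_left_mono)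
    with w(2)[of j] have "J (w j) \<le> m + 1" by (meson less_imp_le order_trans)
    with IF[OF w(1)[of j]] show ?thesis by (simp add: J_def)
  qed
  have w_abs: "\<bar>w j x\<bar> \<le> M" for j x using wE(2,3)[of j x] by simp
  obtain \<sigma> :: "nat \<Rightarrow> nat" where \<sigma>: "strict_mono \<sigma>" "AE x in lborel. convergent (\<lambda>j. w (\<sigma> j) x)"
    by (rule bounded_energy_subsequence[OF s(1) wE(1) w_abs Ebound \<Omega>_measurable \<Omega>_finite])
  define v where "v j = w (\<sigma> j)" for j
  have vO: "v j \<in> obstacle_class" and vE: "v j \<in> energy_space s \<Omega>" and v_bd: "0 \<le> v j x" "v j x \<le> M" for j x
    using w(1) wE by (auto simp: v_def)
  have [measurable]: "v j \<in> borel_measurable borel" for j by (rule energy_spaceD(1)[OF vE])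
  \<comment> \<open>The value \<open>0\<close> off the set of convergence keeps \<open>u\<close> Borel and inside \<open>[0, M]\<close>.\<close>
  define u where "u x = (if Cauchy (\<lambda>j. v j x) then lim (\<lambda>j. v j x) else 0)" for x
  have u_meas [measurable]: "u \<in> borel_measurable borel" unfolding u_def by measurable
  have u_lim: "(\<lambda>j. v j x) \<longlonglongrightarrow> u x" if "Cauchy (\<lambda>j. v j x)" for x
    using that by (simp add: u_def Cauchy_convergent_iff convergent_LIMSEQ_iff)
  have AEu: "AE x in lborel. (\<lambda>j. v j x) \<longlonglongrightarrow> u x"
    using \<sigma>(2) by eventually_elim (auto simp: v_def Cauchy_convergent_iff intro!: u_lim[unfolded v_def])
  have u_bd: "0 \<le> u x" "u x \<le> M" for x
  proof -
    show "0 \<le> u x"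
    proof (cases "Cauchy (\<lambda>j. v j x)")
      case True
      show ?thesis by (rule LIMSEQ_le_const[OF u_lim[OF True]]) (use v_bd in auto)
    qed (simp add: u_def)
    show "u x \<le> M"
    proof (cases "Cauchy (\<lambda>j. v j x)")
      case True
      show ?thesis by (rule LIMSEQ_le_const2[OF u_lim[OF True]]) (use v_bd in auto)
    qed (use M in \<open>simp add: u_def\<close>)
  qed
  have u0: "u x = 0" if "x \<notin> \<Omega>" for x
  proof -
    have v0: "(\<lambda>j. v j x) = (\<lambda>_. 0)" using energy_spaceD(2)[OF vE that] by auto
    then have "Cauchy (\<lambda>j. v j x)" by (simp add: convergent_Cauchy convergent_const)
    from u_lim[OF this] show ?thesis unfolding v0 by (simp add: LIMSEQ_const_iff)
  qed
  have IFlim: "(\<lambda>j. LINT x|lborel. F (v j x)) \<longlonglongrightarrow> (LINT x|lborel. F (u x))"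
  proof (rule integral_dominated_convergence[OF _ _ integrable_\<Omega>[of c]])
    show "AE x in lborel. (\<lambda>j. F (v j x)) \<longlonglongrightarrow> F (u x)"
      using AEu
    proof eventually_elim
      case (elim x)
      show ?case
        by (rule continuous_on_tendsto_compose[OF F_continuous elim]) auto
    qed
    show "AE x in lborel. norm (F (v j x)) \<le> c * indicator \<Omega> x" for j
      using F_c[OF vO] by (intro always_eventually allI)
  qed measurable
  have "(\<lambda>j. 2 * (J (v j) + (LINT x|lborel. F (v j x)))) \<longlonglongrightarrow> 2 * (m + (LINT x|lborel. F (u x)))"
    using LIMSEQ_subseq_LIMSEQ[OF Jw \<sigma>(1)] IFlim by (intro tendsto_intros) (simp_all add: v_def o_def)
  then have Elim: "(\<lambda>j. energy s (v j) (v j)) \<longlonglongrightarrow> 2 * (m + (LINT x|lborel. F (u x)))"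
    by (simp add: J_def)
  note fatou = energy_fatou[OF vE u_meas AEu Elim]
  have "integrable lborel (\<lambda>x. (u x)\<^sup>2)"
  proof (rule Bochner_Integration.integrable_bound[OF integrable_\<Omega>[of "M\<^sup>2"]])
    show "AE x in lborel. norm ((u x)\<^sup>2) \<le> norm (M\<^sup>2 * indicator \<Omega> x :: real)"
    proof (intro always_eventually allI)
      fix x show "norm ((u x)\<^sup>2) \<le> norm (M\<^sup>2 * indicator \<Omega> x :: real)"
        using power_mono[OF u_bd(2) u_bd(1), of x 2] u0[of x] by (cases "x \<in> \<Omega>") auto
    qed
  qed measurable
  then have "u \<in> energy_space s \<Omega>"
    using u0 fatou(1) by (auto simp: energy_space_def)
  then have uO: "u \<in> obstacle_class" using u_bd by (auto simp: obstacle_class_def)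
  have "J u \<le> m" using fatou(2) by (simp add: J_def)
  then have "J u \<le> J w" if "w \<in> energy_space s \<Omega>" for w
    using m_le[OF clamp_in_obstacle_class[OF that]] J_clamp_le[OF that] by linarith
  with uO show ?thesis by (rule that)
qed

end

section \<open>The Euler--Lagrange equation\<close>

text \<open>
  Pointwise: the map \<open>t \<mapsto> max t 0\<close> is nondecreasing and 1-Lipschitz.
\<close>
lemma energy_positive_part:
  assumes w: "w \<in> energy_space s \<Omega>"
  shows "energy s (\<lambda>x. max (w x) 0) (\<lambda>x. max (w x) 0) \<le> energy s w (\<lambda>x. max (w x) 0)"
proof -
  let ?p = "\<lambda>x. max (w x) 0"
  have p: "?p \<in> energy_space s \<Omega>"
    using energy_space_min_max(2)[OF w energy_space_zero] .
  show ?thesis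
    unfolding energy_def
  proof (rule integral_mono)
    show "integrable lborel (gagliardo_integrand s ?p ?p)" by (rule energy_spaceD(4)[OF p])
    show "integrable lborel (gagliardo_integrand s w ?p)" by (rule integrable_gagliardo_integrand[OF w p])
    fix z :: "(real ^ 'a) \<times> (real ^ 'a)"
    obtain x y where z: "z = (x, y)" by (cases z)
    have "(max a 0 - max c 0) * (max a 0 - max c 0) \<le> (a - c) * (max a 0 - max c 0)" for a c :: real
      by (auto simp: max_def algebra_simps mult_le_0_iff mult_nonpos_nonpos mult_nonneg_nonpos)
    then show "gagliardo_integrand s ?p ?p z \<le> gagliardo_integrand s w ?p z"
      by (simp add: z gagliardo_integrand_eq divide_right_mono)
  qed
qed

context singular_problem begin

context
  fixes u :: "real ^ 'n \<Rightarrow> real"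
  assumes u: "u \<in> obstacle_class" and min_u: "\<And>w. w \<in> energy_space s \<Omega> \<Longrightarrow> J u \<le> J w"
begin

lemma u_space: "u \<in> energy_space s \<Omega>" and u_nonneg: "0 \<le> u x" and u_le: "u x \<le> M"
  using u by (auto simp: obstacle_class_def)

lemma u_measurable [measurable]: "u \<in> borel_measurable borel"
  by (rule energy_spaceD(1)[OF u_space])

lemma variation:
  assumes v: "v \<in> energy_space s \<Omega>"
  shows "(LINT x|lborel. F (u x + \<tau> * v x) - F (u x)) \<le> \<tau> * energy s u v + \<tau>\<^sup>2 / 2 * energy s v v"
proof -
  have w: "(\<lambda>x. u x + \<tau> * v x) \<in> energy_space s \<Omega>"
    by (rule energy_space_add_scaled[OF u_space v])
  show ?thesis
    using min_u[OF w] F_composition_integrable[OF w] F_composition_integrable[OF u_space]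
    by (simp add: J_def energy_expand[OF u_space v] field_simps)
qed

lemma variation_quotient:
  assumes v: "v \<in> energy_space s \<Omega>" and \<tau>: "0 < \<tau>"
  shows "integrable lborel (\<lambda>x. (F (u x + \<tau> * v x) - F (u x)) / \<tau>)"
    and "(LINT x|lborel. (F (u x + \<tau> * v x) - F (u x)) / \<tau>) \<le> energy s u v + \<tau> * (energy s v v / 2)"
proof -
  have w: "(\<lambda>x. u x + \<tau> * v x) \<in> energy_space s \<Omega>"
    by (rule energy_space_add_scaled[OF u_space v])
  show "integrable lborel (\<lambda>x. (F (u x + \<tau> * v x) - F (u x)) / \<tau>)"
    using F_composition_integrable[OF w] F_composition_integrable[OF u_space] by simp
  have "(LINT x|lborel. F (u x + \<tau> * v x) - F (u x)) / \<tau>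
     \<le> (\<tau> * energy s u v + \<tau>\<^sup>2 / 2 * energy s v v) / \<tau>"
    using variation[OF v, of \<tau>] \<tau> by (intro divide_right_mono) auto
  also have "\<dots> = energy s u v + \<tau> * (energy s v v / 2)"
    using \<tau> by (simp add: field_simps power2_eq_square)
  finally show "(LINT x|lborel. (F (u x + \<tau> * v x) - F (u x)) / \<tau>) \<le> energy s u v + \<tau> * (energy s v v / 2)"
    by simp
qed

text \<open>
  Let \<open>Z\<close> be the zero set of \<open>u\<close> in \<Omega>. Moving by \<open>\<tau> * w\<close> with \<open>w > 0\<close> gains a term of order
  \<open>\<tau> powr r\<close> from \<open>Z\<close> and costs only an energy of order \<tau>. As \<open>r < 1\<close>, letting \<tau> tend to \<open>0\<close>
  shows that \<open>Z\<close> is null.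
\<close>
lemma u_positive: "AE x in lborel. x \<in> \<Omega> \<longrightarrow> 0 < u x"
proof -
  obtain w D where w: "w \<in> energy_space s \<Omega>" and w_pos: "\<And>x. x \<in> \<Omega> \<Longrightarrow> w x > 0"
    and w_bd: "\<And>x. 0 \<le> w x \<and> w x \<le> D"
    using ex_positive_in_energy_space[OF s \<Omega>] by metis
  note [measurable] = energy_spaceD(1)[OF w]
  define Z where "Z = {x \<in> \<Omega>. u x = 0}"
  have [measurable]: "Z \<in> sets borel" unfolding Z_def by measurable
  define f where "f x = indicator Z x * w x powr r" for x
  have [measurable]: "f \<in> borel_measurable borel" unfolding f_def by measurable
  have f_int: "integrable lborel f"
  proof (rule Bochner_Integration.integrable_bound[OF integrable_\<Omega>[of "D powr r"]])
    have "w x powr r \<le> D powr r" for x using w_bd[of x] r by (intro powr_mono2) auto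
    then show "AE x in lborel. norm (f x) \<le> norm (D powr r * indicator \<Omega> x :: real)"
      by (intro always_eventually) (auto simp: f_def Z_def indicator_def)
  qed measurable
  have f_nonneg: "0 \<le> f x" for x by (simp add: f_def)
  define C where "C = energy s u w + energy s w w / 2"
  have I_le: "lam / r * (LINT x|lborel. f x) \<le> \<tau> powr (1 - r) * C" if \<tau>: "0 < \<tau>" "\<tau> \<le> 1" for \<tau>
  proof -
    have "(\<tau> powr r * (lam / r)) * (LINT x|lborel. f x) = (LINT x|lborel. \<tau> powr r * (lam / r) * f x)"
      by simp
    also have "\<dots> \<le> (LINT x|lborel. F (u x + \<tau> * w x) - F (u x))"
    proof (rule integral_mono)
      show "integrable lborel (\<lambda>x. F (u x + \<tau> * w x) - F (u x))"
        using F_composition_integrable[OF energy_space_add_scaled[OF u_space w]] F_composition_integrable[OF u_space]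
        by simp
      show "\<tau> powr r * (lam / r) * f x \<le> F (u x + \<tau> * w x) - F (u x)" for x
      proof (cases "x \<in> Z")
        case True
        then show ?thesis
          using F_ge_power[of "\<tau> * w x"] w_bd[of x] \<tau>
          by (simp add: f_def Z_def F_nonpos powr_mult mult_ac)
      next
        case False
        then show ?thesis
          using F_mono[of "u x" "u x + \<tau> * w x"] w_bd[of x] \<tau> by (simp add: f_def)
      qed
    qed (use f_int in simp)
    also have "\<dots> \<le> \<tau> * energy s u w + \<tau>\<^sup>2 / 2 * energy s w w"
      by (rule variation[OF w])
    also have "\<tau>\<^sup>2 / 2 * energy s w w \<le> \<tau> / 2 * energy s w w"
      using \<tau> energy_self_nonneg[of s w]
      by (intro mult_right_mono) (auto simp: power2_eq_square mult_left_le)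
    also have "\<tau> * energy s u w + \<tau> / 2 * energy s w w = \<tau> powr r * (\<tau> powr (1 - r) * C)"
    proof -
      have "\<tau> powr r * \<tau> powr (1 - r) = \<tau>" using \<tau> by (simp flip: powr_add)
      then have "\<tau> powr r * (\<tau> powr (1 - r) * C) = \<tau> * C" by (simp add: mult.assoc[symmetric])
      then show ?thesis by (simp add: C_def algebra_simps)
    qed
    finally have "\<tau> powr r * (lam / r * (LINT x|lborel. f x)) \<le> \<tau> powr r * (\<tau> powr (1 - r) * C)"
      by (simp add: mult_ac)
    then show ?thesis by (rule mult_left_le_imp_le) (use \<tau> in simp)
  qed
  have "(\<lambda>k. inverse (real (Suc k)) powr (1 - r) * C) \<longlonglongrightarrow> 0 powr (1 - r) * C"
    by (intro tendsto_mult tendsto_const tendsto_powr'[OF LIMSEQ_inverse_real_of_nat]) (use r in auto)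
  then have "(\<lambda>k. inverse (real (Suc k)) powr (1 - r) * C) \<longlonglongrightarrow> 0" by simp
  then have "lam / r * (LINT x|lborel. f x) \<le> 0"
    by (rule LIMSEQ_le_const) (use I_le in \<open>auto simp: inverse_le_1_iff\<close>)
  moreover have "0 \<le> (LINT x|lborel. f x)"
    by (rule Bochner_Integration.integral_nonneg) (rule f_nonneg)
  ultimately have "(LINT x|lborel. f x) = 0"
    using lam r by (auto simp: field_simps mult_le_0_iff)
  then have "AE x in lborel. f x = 0"
    using integral_nonneg_eq_0_iff_AE[OF f_int] f_nonneg by simp
  then show ?thesis
  proof eventually_elim
    case (elim x)
    show ?case
      using elim w_pos[of x] u_nonneg[of x] by (auto simp: f_def Z_def indicator_def less_le)
  qed
qed

lemma F_quotient_limit: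
  assumes "0 < t" and \<tau>: "\<tau> \<longlonglongrightarrow> 0" "\<And>k. \<tau> k \<noteq> 0"
  shows "(\<lambda>k. (F (t + \<tau> k * c) - F t) / \<tau> k) \<longlonglongrightarrow> h t * c"
proof -
  have "((\<lambda>x. F (t + x * c)) has_real_derivative h (t + 0 * c) * c) (at 0)"
    by (rule DERIV_chain2[of F]) (use F_deriv[OF assms(1)] in \<open>auto intro!: derivative_eq_intros\<close>)
  then have "((\<lambda>x. (F (t + x * c) - F t) / x) \<longlongrightarrow> h t * c) (at 0)"
    by (simp add: has_field_derivative_iff)
  moreover have "filterlim \<tau> (at 0) sequentially"
    using \<tau> by (simp add: filterlim_at)
  ultimately show ?thesis by (rule filterlim_compose)
qed

text \<open>
  \<open>F\<close> is nondecreasing, so the difference quotients \<open>q k\<close> in the direction of a nonnegative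
  \<open>v\<close> are nonnegative, and Fatou's lemma applies without prior knowledge that the singular
  term is integrable.
\<close>
lemma test_lower:
  assumes v: "v \<in> energy_space s \<Omega>" and v0: "\<And>x. 0 \<le> v x"
  shows "integrable lborel (\<lambda>x. h (u x) * v x)" and "(LINT x|lborel. h (u x) * v x) \<le> energy s u v"
proof -
  note [measurable] = energy_spaceD(1)[OF v]
  define \<tau> where "\<tau> k = inverse (real (Suc k))" for k
  have \<tau>: "\<tau> \<longlonglongrightarrow> 0" "0 < \<tau> k" for k
    unfolding \<tau>_def using LIMSEQ_inverse_real_of_nat by simp_all
  define q where "q k x = (F (u x + \<tau> k * v x) - F (u x)) / \<tau> k" for k x
  have [measurable]: "q k \<in> borel_measurable borel" for k unfolding q_def by measurable
  have q0: "0 \<le> q k x" for k x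
    using F_mono[of "u x" "u x + \<tau> k * v x"] \<tau>(2)[of k] v0[of x] by (simp add: q_def)
  have qi: "integrable lborel (q k)" "(LINT x|lborel. q k x) \<le> energy s u v + \<tau> k * (energy s v v / 2)" for k
    unfolding q_def by (rule variation_quotient[OF v \<tau>(2)])+
  define e where "e k = energy s u v + \<tau> k * (energy s v v / 2)" for k
  have "e \<longlonglongrightarrow> energy s u v + 0 * (energy s v v / 2)"
    unfolding e_def by (intro tendsto_intros \<tau>(1))
  then have e: "e \<longlonglongrightarrow> energy s u v" by simp
  have "AE x in lborel. ennreal (h (u x) * v x) = liminf (\<lambda>k. ennreal (q k x))"
    using u_positive
  proof eventually_elim
    case (elim x)
    have "(\<lambda>k. q k x) \<longlonglongrightarrow> h (u x) * v x"
    proof (cases "x \<in> \<Omega>")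
      case True
      then show ?thesis
        unfolding q_def using elim \<tau> by (intro F_quotient_limit) (auto simp: less_imp_neq[symmetric])
    next
      case False
      then show ?thesis
        using energy_spaceD(2)[OF v] by (simp add: q_def)
    qed
    then show ?case
      by (intro lim_imp_Liminf[symmetric] tendsto_ennrealI) auto
  qed
  then have "(\<integral>\<^sup>+ x. ennreal (h (u x) * v x) \<partial>lborel) = (\<integral>\<^sup>+ x. liminf (\<lambda>k. ennreal (q k x)) \<partial>lborel)"
    by (rule nn_integral_cong_AE)
  also have "\<dots> \<le> liminf (\<lambda>k. \<integral>\<^sup>+ x. ennreal (q k x) \<partial>lborel)"
    by (rule nn_integral_liminf) simp
  also have "\<dots> \<le> liminf (\<lambda>k. ennreal (e k))"
  proof (rule Liminf_mono, intro always_eventually allI)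
    fix k
    have "(\<integral>\<^sup>+ x. ennreal (q k x) \<partial>lborel) = ennreal (LINT x|lborel. q k x)"
      by (rule nn_integral_eq_integral[OF qi(1)]) (simp add: q0)
    also have "\<dots> \<le> ennreal (e k)" unfolding e_def by (rule ennreal_leI[OF qi(2)])
    finally show "(\<integral>\<^sup>+ x. ennreal (q k x) \<partial>lborel) \<le> ennreal (e k)" .
  qed
  also have "\<dots> = ennreal (energy s u v)"
    by (intro lim_imp_Liminf tendsto_ennrealI e) simp
  finally have le: "(\<integral>\<^sup>+ x. ennreal (h (u x) * v x) \<partial>lborel) \<le> ennreal (energy s u v)" .
  have "0 \<le> e k" for k
  proof -
    have "0 \<le> (LINT x|lborel. q k x)" by (rule Bochner_Integration.integral_nonneg) (rule q0)
    then show ?thesis using qi(2)[of k] by (simp add: e_def)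
  qed
  then have E0: "0 \<le> energy s u v"
    using LIMSEQ_le_const[OF e] by blast
  have hv0: "0 \<le> h (u x) * v x" for x using h_nonneg v0 by simp
  show i: "integrable lborel (\<lambda>x. h (u x) * v x)"
  proof (rule integrableI_nonneg)
    show "(\<integral>\<^sup>+ x. ennreal (h (u x) * v x) \<partial>lborel) < \<infinity>"
      using le by (rule le_less_trans) simp
  qed (use hv0 in auto)
  show "(LINT x|lborel. h (u x) * v x) \<le> energy s u v"
    using le E0 by (subst (asm) nn_integral_eq_integral[OF i]) (use hv0 in auto)
qed

text \<open>
  With \<open>v \<le> K * u\<close>, a step of size at most \<open>1 / (2 * K)\<close> downwards along \<open>v\<close> leaves at least
  half of \<open>u\<close>. There the slope of \<open>F\<close> is at most \<open>2 * h (u x) + \<beta>\<close>, which gives the dominating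
  function for the limit of the difference quotients.
\<close>
lemma test_upper_dominated:
  assumes v: "v \<in> energy_space s \<Omega>" and v0: "\<And>x. 0 \<le> v x" and K: "0 < K" and vK: "\<And>x. v x \<le> K * u x"
  shows "energy s u v \<le> (LINT x|lborel. h (u x) * v x)"
proof -
  note [measurable] = energy_spaceD(1)[OF v]
  define \<tau> where "\<tau> k = - (inverse (real (Suc k)) / (2 * K))" for k
  have \<tau>_lim: "\<tau> \<longlonglongrightarrow> 0"
  proof -
    have "\<tau> \<longlonglongrightarrow> - (0 / (2 * K))"
      unfolding \<tau>_def using K by (intro tendsto_intros LIMSEQ_inverse_real_of_nat) auto
    then show ?thesis by simp
  qed
  have \<tau>: "\<tau> k < 0" "- \<tau> k * K \<le> 1 / 2" for k
  proof -
    show "\<tau> k < 0" using K by (simp add: \<tau>_def)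
    have "- \<tau> k * K = inverse (real (Suc k)) / 2"
      using K by (simp add: \<tau>_def del: of_nat_Suc)
    also have "\<dots> \<le> 1 / 2" by (simp add: inverse_le_1_iff)
    finally show "- \<tau> k * K \<le> 1 / 2" .
  qed
  define q where "q k x = (F (u x + \<tau> k * v x) - F (u x)) / \<tau> k" for k x
  have [measurable]: "q k \<in> borel_measurable borel" for k unfolding q_def by measurable
  have q_ge: "energy s u v + \<tau> k * (energy s v v / 2) \<le> (LINT x|lborel. q k x)" for k
  proof -
    have "(\<tau> k * energy s u v + (\<tau> k)\<^sup>2 / 2 * energy s v v) / \<tau> k
        \<le> (LINT x|lborel. F (u x + \<tau> k * v x) - F (u x)) / \<tau> k"
      using variation[OF v, of "\<tau> k"] \<tau>(1)[of k] by (intro divide_right_mono_neg) auto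
    moreover have "(\<tau> k * energy s u v + (\<tau> k)\<^sup>2 / 2 * energy s v v) / \<tau> k = energy s u v + \<tau> k * (energy s v v / 2)"
      using \<tau>(1)[of k] by (simp add: field_simps power2_eq_square)
    ultimately show ?thesis by (simp add: q_def)
  qed
  have v_int: "integrable lborel v" by (rule energy_space_integrable[OF v \<Omega>_measurable \<Omega>_finite])
  have q_lim: "(\<lambda>k. LINT x|lborel. q k x) \<longlonglongrightarrow> (LINT x|lborel. h (u x) * v x)"
  proof (rule integral_dominated_convergence)
    show "integrable lborel (\<lambda>x. 2 * (h (u x) * v x) + \<beta> * v x)"
      using test_lower(1)[OF v v0] v_int by simp
    show "AE x in lborel. (\<lambda>k. q k x) \<longlonglongrightarrow> h (u x) * v x"
      using u_positive
    proof eventually_elim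
      case (elim x)
      show ?case
      proof (cases "x \<in> \<Omega>")
        case True
        then show ?thesis
          unfolding q_def using elim \<tau> \<tau>_lim by (intro F_quotient_limit) (auto simp: less_imp_neq)
      next
        case False
        then show ?thesis
          using energy_spaceD(2)[OF v] by (simp add: q_def)
      qed
    qed
    fix k
    show "AE x in lborel. norm (q k x) \<le> 2 * (h (u x) * v x) + \<beta> * v x"
      using u_positive
    proof eventually_elim
      case (elim x)
      show ?case
      proof (cases "x \<in> \<Omega> \<and> 0 < v x")
        case False
        then have "v x = 0" using energy_spaceD(2)[OF v, of x] v0[of x] by force
        then show ?thesis by (simp add: q_def)
      next
        case True
        then have ux: "0 < u x" and vx: "0 < v x" using elim by auto
        have "- \<tau> k * v x \<le> - \<tau> k * (K * u x)"
          using \<tau>(1)[of k] vK[of x] by (intro mult_left_mono) auto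
        also have "\<dots> \<le> 1 / 2 * u x"
          using \<tau>(2)[of k] ux by (simp only: mult.assoc[symmetric]) (intro mult_right_mono, auto)
        finally have low: "u x / 2 \<le> u x + \<tau> k * v x" by simp
        have "u x + \<tau> k * v x < u x" using \<tau>(1)[of k] vx by (simp add: mult_neg_pos)
        then obtain z where z: "u x + \<tau> k * v x < z" "z < u x"
          "F (u x) - F (u x + \<tau> k * v x) = (u x - (u x + \<tau> k * v x)) * h z"
          using MVT2[of "u x + \<tau> k * v x" "u x" F h] F_deriv low ux by force
        have "q k x = v x * h z"
          using z(3) \<tau>(1)[of k] by (simp add: q_def field_simps)
        moreover have "h z \<le> 2 * h (u x) + \<beta>"
        proof -
          have "z powr (r - 1) \<le> (u x / 2) powr (r - 1)"
            using z(1) low ux r by (intro powr_mono2') auto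
          also have "\<dots> = (1 / 2) powr (r - 1) * u x powr (r - 1)"
            using ux powr_mult[of "1 / 2" "u x" "r - 1"] by simp
          also have "(1 / 2 :: real) powr (r - 1) \<le> (1 / 2) powr (- 1)"
            using r by (intro powr_mono') auto
          also have "(1 / 2 :: real) powr (- 1) = 2" by (simp add: powr_minus)
          finally have "z powr (r - 1) \<le> 2 * u x powr (r - 1)" by (simp add: mult_right_mono)
          then have "lam * z powr (r - 1) \<le> lam * (2 * u x powr (r - 1))"
            using lam by (intro mult_left_mono) auto
          then show ?thesis
            using b_le[of z] b_nonneg[of "u x"] by (simp add: h_def)
        qed
        ultimately have "q k x \<le> 2 * (h (u x) * v x) + \<beta> * v x"
          using vx mult_left_mono[of "h z" "2 * h (u x) + \<beta>" "v x"] by (simp add: algebra_simps)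
        moreover have "0 \<le> q k x" using \<open>q k x = v x * h z\<close> vx h_nonneg by simp
        ultimately show ?thesis by simp
      qed
    qed
  qed measurable
  have e_lim: "(\<lambda>k. energy s u v + \<tau> k * (energy s v v / 2)) \<longlonglongrightarrow> energy s u v + 0 * (energy s v v / 2)"
    by (intro tendsto_intros \<tau>_lim)
  have "energy s u v + 0 * (energy s v v / 2) \<le> (LINT x|lborel. h (u x) * v x)"
    by (rule LIMSEQ_le[OF e_lim q_lim]) (use q_ge in auto)
  then show ?thesis by simp
qed

text \<open>
  Split \<open>v = y + z\<close> with \<open>y = min v (K * u)\<close> and \<open>z\<close> the positive part of \<open>d = v - K * u\<close>. The
  dominated case handles \<open>y\<close>. For the other part, \<open>energy s z z \<le> energy s z d\<close> gives
  \<open>K * energy s z u \<le> energy s z v - energy s z z\<close>, and completing the square bounds this by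
  \<open>energy s v v / 4\<close>.
\<close>
lemma test_upper:
  assumes v: "v \<in> energy_space s \<Omega>" and v0: "\<And>x. 0 \<le> v x"
  shows "energy s u v \<le> (LINT x|lborel. h (u x) * v x)"
proof -
  have est: "energy s u v \<le> (LINT x|lborel. h (u x) * v x) + energy s v v / (4 * K)" if K: "0 < K" for K
  proof -
    define d where "d x = v x + (- K) * u x" for x
    define z where "z x = max (d x) 0" for x
    define y where "y x = min (v x) (K * u x)" for x
    have d: "d \<in> energy_space s \<Omega>" unfolding d_def by (rule energy_space_add_scaled[OF v u_space])
    have z: "z \<in> energy_space s \<Omega>" unfolding z_def by (rule energy_space_min_max(2)[OF d energy_space_zero])
    have Ku: "(\<lambda>x. K * u x) \<in> energy_space s \<Omega>"
      using energy_space_add_scaled[OF energy_space_zero u_space, of K] by simp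
    have y: "y \<in> energy_space s \<Omega>" unfolding y_def by (rule energy_space_min_max(1)[OF v Ku])
    have y0: "0 \<le> y x" and yK: "y x \<le> K * u x" and yv: "y x \<le> v x" for x
      using v0[of x] u_nonneg[of x] K by (auto simp: y_def)
    have v_eq: "v = (\<lambda>x. y x + 1 * z x)"
      by (auto simp: y_def z_def d_def)
    have "energy s u v = energy s u y + 1 * energy s u z"
      by (subst v_eq) (rule energy_add_scaled[OF u_space y z])
    moreover have "energy s u y \<le> (LINT x|lborel. h (u x) * v x)"
    proof -
      have "energy s u y \<le> (LINT x|lborel. h (u x) * y x)"
        by (rule test_upper_dominated[OF y y0 K yK])
      also have "\<dots> \<le> (LINT x|lborel. h (u x) * v x)"
        by (intro integral_mono test_lower(1) y y0 v v0 mult_left_mono yv h_nonneg)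
      finally show ?thesis .
    qed
    moreover have "energy s u z \<le> energy s v v / (4 * K)"
    proof -
      have "energy s z d = energy s z v + (- K) * energy s z u"
        unfolding d_def by (rule energy_add_scaled[OF z v u_space])
      moreover have "energy s z z \<le> energy s z d"
        using energy_positive_part[OF d] unfolding z_def[symmetric] by (simp add: energy_commute)
      moreover have "0 \<le> energy s z z + 2 * (- (1 / 2)) * energy s z v + (- (1 / 2))\<^sup>2 * energy s v v"
        unfolding energy_expand[OF z v, symmetric] by (rule energy_self_nonneg)
      ultimately have "K * energy s z u \<le> energy s v v / 4"
        by (simp add: power2_eq_square)
      then show ?thesis
        using K by (simp add: energy_commute[of s u z] field_simps)
    qed
    ultimately show ?thesis by simp
  qed
  have "(\<lambda>k. (LINT x|lborel. h (u x) * v x) + energy s v v / 4 * inverse (real (Suc k)))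
      \<longlonglongrightarrow> (LINT x|lborel. h (u x) * v x) + energy s v v / 4 * 0"
    by (intro tendsto_intros LIMSEQ_inverse_real_of_nat)
  then have "(\<lambda>k. (LINT x|lborel. h (u x) * v x) + energy s v v / 4 * inverse (real (Suc k)))
      \<longlonglongrightarrow> (LINT x|lborel. h (u x) * v x)" by simp
  then show ?thesis
  proof (rule LIMSEQ_le_const)
    show "\<exists>N. \<forall>k\<ge>N. energy s u v \<le> (LINT x|lborel. h (u x) * v x) + energy s v v / 4 * inverse (real (Suc k))"
    proof (intro exI allI impI)
      fix k
      have "energy s v v / (4 * real (Suc k)) = energy s v v / 4 * inverse (real (Suc k))"
        by (metis divide_divide_eq_left divide_inverse)
      then show "energy s u v \<le> (LINT x|lborel. h (u x) * v x) + energy s v v / 4 * inverse (real (Suc k))"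
        using est[of "real (Suc k)"] by (simp only: of_nat_0_less_iff zero_less_Suc simp_thms)
    qed
  qed
qed

text \<open>
  Both inequalities hold for nonnegative test functions; a general one is the difference of
  its positive and negative parts.
\<close>
lemma euler_lagrange:
  assumes v: "v \<in> energy_space s \<Omega>"
  shows "integrable lborel (\<lambda>x. h (u x) * v x)" and "energy s u v = (LINT x|lborel. h (u x) * v x)"
proof -
  define p where "p x = max (v x) 0" for x
  define m where "m x = max (- v x) 0" for x
  have nv: "(\<lambda>x. - v x) \<in> energy_space s \<Omega>"
    using energy_space_add_scaled[OF energy_space_zero v, of "-1"] by simp
  have p: "p \<in> energy_space s \<Omega>" unfolding p_def by (rule energy_space_min_max(2)[OF v energy_space_zero])
  have m: "m \<in> energy_space s \<Omega>" unfolding m_def by (rule energy_space_min_max(2)[OF nv energy_space_zero])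
  have 0: "0 \<le> p x" "0 \<le> m x" for x by (auto simp: p_def m_def)
  have v_eq: "v = (\<lambda>x. p x + (- 1) * m x)" by (auto simp: p_def m_def)
  have ip: "integrable lborel (\<lambda>x. h (u x) * p x)" and im: "integrable lborel (\<lambda>x. h (u x) * m x)"
    using test_lower(1) p m 0 by auto
  have hv: "h (u x) * v x = h (u x) * p x - h (u x) * m x" for x
    by (subst v_eq) (simp add: algebra_simps)
  show "integrable lborel (\<lambda>x. h (u x) * v x)"
    unfolding hv using ip im by simp
  have "energy s u p = (LINT x|lborel. h (u x) * p x)"
    using test_lower(2)[OF p 0(1)] test_upper[OF p 0(1)] by simp
  moreover have "energy s u m = (LINT x|lborel. h (u x) * m x)"
    using test_lower(2)[OF m 0(2)] test_upper[OF m 0(2)] by simp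
  moreover have "energy s u v = energy s u p + (- 1) * energy s u m"
    by (subst v_eq) (rule energy_add_scaled[OF u_space p m])
  ultimately show "energy s u v = (LINT x|lborel. h (u x) * v x)"
    unfolding hv using ip im by simp
qed

end

theorem solution_exists:
  obtains u where "u \<in> energy_space s \<Omega>" "\<And>x. 0 \<le> u x" "\<And>x. u x \<le> M"
    "AE x in lborel. x \<in> \<Omega> \<longrightarrow> 0 < u x"
    "\<And>v. v \<in> energy_space s \<Omega> \<Longrightarrow> integrable lborel (\<lambda>x. h (u x) * v x)"
    "\<And>v. v \<in> energy_space s \<Omega> \<Longrightarrow> energy s u v = (LINT x|lborel. h (u x) * v x)"
proof -
  obtain u where u: "u \<in> obstacle_class" "\<And>w. w \<in> energy_space s \<Omega> \<Longrightarrow> J u \<le> J w"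
    using J_minimizer_exists by blast
  show ?thesis
    by (rule that[OF u_space[OF u] u_nonneg[OF u] u_le[OF u] u_positive[OF u]
          euler_lagrange(1)[OF u] euler_lagrange(2)[OF u]])
qed

end

section \<open>The Sobolev constant, the maximum of k and solvability\<close>

lemma lebesgue_integral_AE_transfer:
  fixes f g :: "'a::euclidean_space \<Rightarrow> real"
  assumes f: "f \<in> borel_measurable borel" and eq: "AE x in lborel. f x = g x"
  shows "integrable lborel f \<Longrightarrow> integrable lebesgue g"
    and "(LINT x|lebesgue. g x) = (LINT x|lborel. f x)"
proof -
  have g: "g \<in> borel_measurable lebesgue"
    by (rule borel_measurable_completion_AE[OF _ eq]) (use f in simp)
  have f': "f \<in> borel_measurable lebesgue" using f by (simp add: measurable_completion)
  have eq': "AE x in lebesgue. f x = g x" by (rule AE_completion[OF eq])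
  show "integrable lebesgue g" if "integrable lborel f"
  proof -
    have "integrable lebesgue f" using that f by (subst integrable_completion) auto
    then show ?thesis by (rule integrable_cong_AE_imp[OF _ g]) (use eq' in \<open>simp add: eq_commute\<close>)
  qed
  have "(LINT x|lebesgue. g x) = (LINT x|lebesgue. f x)"
    by (rule integral_cong_AE[OF g f']) (use eq' in \<open>simp add: eq_commute\<close>)
  also have "\<dots> = (LINT x|lborel. f x)" using f by (subst integral_completion) auto
  finally show "(LINT x|lebesgue. g x) = (LINT x|lborel. f x)" .
qed

lemma emeasure_open_pos:
  fixes \<Omega> :: "'a::euclidean_space set"
  assumes "open \<Omega>" "\<Omega> \<noteq> {}"
  shows "0 < emeasure lborel \<Omega>"
proof -
  obtain x e where e: "0 < e" "ball x e \<subseteq> \<Omega>"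
    using assms by (metis open_contains_ball ex_in_conv)
  have "0 < measure lborel (ball x e)" using e(1) by simp
  then have "0 < emeasure lborel (ball x e)"
    unfolding measure_def by (simp add: enn2real_positive_iff)
  also have "\<dots> \<le> emeasure lborel \<Omega>"
    using e(2) assms(1) by (intro emeasure_mono) auto
  finally show ?thesis .
qed

text \<open>
  The supremum that defines the constant is meaningful only if the quotients are bounded
  above: this is the Sobolev inequality, applied to Borel representatives. If \<open>\<bar>u\<bar>\<^sup>p\<close> were not
  integrable, its integral would have the default value \<open>0\<close>, and the bound would hold
  trivially. The distance function provides a positive quotient.
\<close>
lemma sobolev_const_pos:
  fixes \<Omega> :: "(real ^ 'n) set"
  assumes s: "0 < s" "s < 1" "2 * s < real CARD('n)"
    and \<Omega>: "open \<Omega>" "bounded \<Omega>" "\<Omega> \<noteq> {}"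
  shows "0 < sobolev_const s \<Omega>"
proof -
  define p where "p = crit_exp CARD('n) s"
  have p: "2 < p" using crit_exp_identities(1)[OF s(1,3)] by (simp add: p_def)
  obtain K where K: "0 < K" and sob: "\<And>u :: real ^ 'n \<Rightarrow> real. \<lbrakk>u \<in> borel_measurable borel;
      integrable lborel (gagliardo_integrand s u u); integrable lborel (\<lambda>x. \<bar>u x\<bar> powr p)\<rbrakk>
      \<Longrightarrow> K * (LINT x|lborel. \<bar>u x\<bar> powr p) powr (2 / p) \<le> energy s u u"
    using fractional_sobolev_inequality[OF s(1,3)] unfolding p_def by metis
  have \<Omega>_meas [measurable]: "\<Omega> \<in> sets borel" using \<Omega>(1) by simp
  define Q where "Q u = Lp_norm p u / X0_norm s u" for u :: "real ^ 'n \<Rightarrow> real"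
  define S where "S = {u \<in> X0 s \<Omega>. \<not> (AE x in lebesgue. u x = 0)}"
  have Q_le: "Q u \<le> sqrt (1 / K)" if "u \<in> S" for u
  proof -
    have "u \<in> X0 s \<Omega>" using that by (simp add: S_def)
    then obtain w where w: "w \<in> energy_space s \<Omega>" "AE x in lborel. u x = w x"
      "gagliardo_form s u u = energy s w w"
      using \<Omega>_meas by (rule X0_representative) blast
    note [measurable] = energy_spaceD(1)[OF w(1)]
    define N where "N = (LINT x|lborel. \<bar>w x\<bar> powr p)"
    have "(LINT x|lebesgue. \<bar>u x\<bar> powr p) = N"
      unfolding N_def
      by (rule lebesgue_integral_AE_transfer(2)) (measurable, use w(2) in eventually_elim, simp)
    then have Lp: "Lp_norm p u = N powr (1 / p)" by (simp add: Lp_norm_def)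
    have "K * N powr (2 / p) \<le> energy s w w"
    proof (cases "integrable lborel (\<lambda>x. \<bar>w x\<bar> powr p)")
      case True
      then show ?thesis
        unfolding N_def by (intro sob energy_spaceD[OF w(1)])
    next
      case False
      then show ?thesis
        using energy_self_nonneg[of s w] by (simp add: N_def not_integrable_integral_eq)
    qed
    then have "(N powr (1 / p))\<^sup>2 \<le> 1 / K * energy s w w"
      using K by (simp add: power2_eq_square field_simps flip: powr_add)
    then have "N powr (1 / p) \<le> sqrt (1 / K * energy s w w)"
      by (rule real_le_rsqrt)
    then have "Lp_norm p u \<le> sqrt (1 / K) * X0_norm s u"
      unfolding Lp X0_norm_def w(3) real_sqrt_mult .
    moreover have "0 \<le> X0_norm s u"
      using energy_self_nonneg[of s w] by (simp add: X0_norm_def w(3))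
    ultimately show ?thesis
      using K by (cases "X0_norm s u = 0") (simp_all add: Q_def divide_le_eq)
  qed
  then have bdd: "bdd_above (Q ` S)" by (rule bdd_aboveI2)
  obtain w D where w: "w \<in> energy_space s \<Omega>" and w_pos: "\<And>x. x \<in> \<Omega> \<Longrightarrow> w x > 0"
    and w_bd: "\<And>x. 0 \<le> w x \<and> w x \<le> D"
    using ex_positive_in_energy_space[OF s(1,2) \<Omega>(1,2)] by metis
  note [measurable] = energy_spaceD(1)[OF w]
  have not_AE: "\<not> (AE x in lborel. w x = 0)"
  proof
    assume "AE x in lborel. w x = 0"
    then have "AE x in lborel. x \<notin> \<Omega>"
      by eventually_elim (use w_pos in force)
    then have "emeasure lborel \<Omega> = 0"
      by (subst (asm) AE_iff_measurable[where N = \<Omega>]) auto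
    then show False using emeasure_open_pos[OF \<Omega>(1,3)] by simp
  qed
  have wp_int: "integrable lborel (\<lambda>x. \<bar>w x\<bar> powr p)"
  proof (rule Bochner_Integration.integrable_bound)
    show "integrable lborel (\<lambda>x. D powr p * indicator \<Omega> x :: real)"
      using emeasure_bounded_finite[OF \<Omega>(2)] by (intro integrable_mult_right integrable_real_indicator) auto
    have "w x powr p \<le> D powr p" for x using w_bd[of x] p by (intro powr_mono2) auto
    then show "AE x in lborel. norm (\<bar>w x\<bar> powr p) \<le> norm (D powr p * indicator \<Omega> x :: real)"
      using w_bd energy_spaceD(2)[OF w] by (intro always_eventually) (auto simp: indicator_def)
  qed measurable
  define N where "N = (LINT x|lborel. \<bar>w x\<bar> powr p)"
  have "N \<noteq> 0"
  proof
    assume "N = 0"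
    then have "AE x in lborel. \<bar>w x\<bar> powr p = 0"
      unfolding N_def using integral_nonneg_eq_0_iff_AE[OF wp_int] by simp
    then have "AE x in lborel. w x = 0" by eventually_elim simp
    with not_AE show False ..
  qed
  moreover have "0 \<le> N" unfolding N_def by (rule Bochner_Integration.integral_nonneg) simp
  ultimately have N: "0 < N" by simp
  then have "0 < K * N powr (2 / p)" using K by simp
  also have "\<dots> \<le> energy s w w"
    unfolding N_def using energy_spaceD[OF w] wp_int by (intro sob)
  finally have "0 < X0_norm s w"
    by (simp add: X0_norm_def energy_space_gagliardo_form)
  moreover have "Lp_norm p w = N powr (1 / p)"
    unfolding Lp_norm_def N_def by (subst integral_completion) auto
  ultimately have "0 < Q w" using N by (simp add: Q_def)
  moreover have "w \<in> S"
    using energy_space_subset_X0[OF w] not_AE by (simp add: S_def AE_completion_iff)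
  then have "Q w \<le> (SUP u\<in>S. Q u)" by (rule cSUP_upper[OF _ bdd])
  ultimately show ?thesis
    by (simp add: sobolev_const_def S_def Q_def p_def)
qed

text \<open>
  The numerator equals \<open>t powr (2 - r) * (1 - C * t powr (p - 2))\<close>: it is positive at \<open>t1\<close> and
  nonpositive beyond \<open>T\<close>, so the maximum over the compact interval \<open>[0, T]\<close> is the global one.
\<close>
lemma arg_max_exists:
  fixes A B C D p q r :: real
  assumes r: "0 < r" "r < 1" and p: "2 < p" and q: "1 \<le> q"
    and pos: "0 < A" "0 < B" "0 < C" "0 < D"
  defines "f \<equiv> \<lambda>t. (t powr (2 - r) - C * t powr (p - r)) / (A + B * t powr (1 - r) + D * t powr (q - r))"
  obtains t0 where "is_arg_max f (\<lambda>t. t \<ge> 0) t0" "0 < f t0"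
proof -
  have den: "0 < A + B * t powr (1 - r) + D * t powr (q - r)" for t
    using pos by (intro add_pos_nonneg) auto
  have num: "t powr (2 - r) - C * t powr (p - r) = t powr (2 - r) * (1 - C * t powr (p - 2))" for t
  proof -
    have "t powr (p - r) = t powr (2 - r) * t powr (p - 2)"
      by (simp flip: powr_add)
    then show ?thesis by (simp add: algebra_simps)
  qed
  define T where "T = (1 / C) powr (1 / (p - 2))"
  define t1 where "t1 = (1 / (2 * C)) powr (1 / (p - 2))"
  have T: "0 < T" "T powr (p - 2) = 1 / C" and t1: "0 < t1" "t1 powr (p - 2) = 1 / (2 * C)"
    using p pos by (simp_all add: T_def t1_def powr_powr)
  have f_far: "f t \<le> 0" if "T \<le> t" for t
  proof -
    have "1 / C \<le> t powr (p - 2)"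
      unfolding T(2)[symmetric] using that T(1) p by (intro powr_mono2) auto
    then have "1 - C * t powr (p - 2) \<le> 0" using pos by (simp add: field_simps)
    then have "t powr (2 - r) * (1 - C * t powr (p - 2)) \<le> 0"
      by (intro mult_nonneg_nonpos) auto
    then show ?thesis
      unfolding f_def num using den[of t] by (intro divide_nonpos_pos)
  qed
  have f_t1: "0 < f t1"
    unfolding f_def num t1(2) using t1(1) pos den[of t1] by (intro divide_pos_pos mult_pos_pos) auto
  then have t1_T: "t1 < T" using f_far[of t1] by force
  have "continuous_on {0..T} f"
    unfolding f_def
  proof (intro continuous_on_divide ballI)
    have pw: "continuous_on {0..T} (\<lambda>t. t powr a)" if "0 < a" for a :: real
      by (rule continuous_on_powr') (use that in \<open>auto intro!: continuous_intros\<close>)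
    show "continuous_on {0..T} (\<lambda>t. t powr (2 - r) - C * t powr (p - r))"
      by (intro continuous_on_diff continuous_on_mult continuous_on_const pw) (use r p in auto)
    show "continuous_on {0..T} (\<lambda>t. A + B * t powr (1 - r) + D * t powr (q - r))"
      by (intro continuous_on_add continuous_on_mult continuous_on_const pw) (use r q in auto)
    show "A + B * t powr (1 - r) + D * t powr (q - r) \<noteq> 0" for t using den[of t] by simp
  qed
  then obtain t0 where t0: "t0 \<in> {0..T}" "\<And>t. t \<in> {0..T} \<Longrightarrow> f t \<le> f t0"
    using continuous_attains_sup[of "{0..T}" f] T(1) by auto
  have f0: "0 < f t0" using t0(2)[of t1] f_t1 t1_T t1(1) by auto
  have "f t \<le> f t0" if "0 \<le> t" for t
    using t0(2)[of t] f_far[of t] f0 that by (cases "t \<le> T") auto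
  then have "is_arg_max f (\<lambda>t. t \<ge> 0) t0"
    using t0(1) by (auto simp: is_arg_max_def not_less)
  then show ?thesis using f0 by (rule that)
qed

text \<open>
  First the barrier \<open>M\<close> is fixed such that the critical power at \<open>M\<close> takes up half of the
  available gain \<open>M * \<kappa>\<close>; then \<open>l0\<close> is the parameter for which the remaining terms take up the
  other half. The solution of the truncated problem has values in \<open>[0, M]\<close>, where both
  right-hand sides agree.
\<close>
lemma weak_solution_exists:
  fixes \<Omega> :: "(real ^ 'n) set"
  assumes s: "0 < s" "s < 1" "2 * s < real CARD('n)"
    and \<Omega>: "open \<Omega>" "bounded \<Omega>"
    and g: "continuous_on {0..} g" "\<And>t. t \<ge> 0 \<Longrightarrow> g t \<ge> 0"
    and r: "0 < r" "r < 1"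
  obtains l0 where "0 < l0" "\<And>l. \<lbrakk>0 < l; l < l0\<rbrakk> \<Longrightarrow> \<exists>u. weak_solution s \<Omega> r g l u"
proof -
  define p where "p = crit_exp CARD('n) s"
  have p: "2 < p" using crit_exp_identities(1)[OF s(1,3)] by (simp add: p_def)
  have \<Omega>_meas [measurable]: "\<Omega> \<in> sets borel" using \<Omega>(1) by simp
  have \<Omega>_fin: "emeasure lborel \<Omega> < \<infinity>" by (rule emeasure_bounded_finite[OF \<Omega>(2)])
  obtain \<kappa> where \<kappa>: "0 < \<kappa>" and gain: "\<And>M w. \<lbrakk>0 \<le> M; w \<in> energy_space s \<Omega>\<rbrakk> \<Longrightarrow>
       energy s (\<lambda>x. min (max (w x) 0) M) (\<lambda>x. min (max (w x) 0) M)
         + 2 * M * \<kappa> * (LINT x|lborel. max (w x - M) 0) \<le> energy s w w"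
    using energy_clamp_gain[OF s(1) \<Omega>_meas \<Omega>(2)] by metis
  define M where "M = (\<kappa> / 2) powr (1 / (p - 2))"
  have M: "0 < M" using \<kappa> by (simp add: M_def)
  have "M powr (p - 2) = \<kappa> / 2" using \<kappa> p by (simp add: M_def powr_powr)
  moreover have "M powr (p - 1) = M powr (p - 2) * M"
    using M powr_add[of M "p - 2" 1] by simp
  ultimately have Mp: "M powr (p - 1) = \<kappa> * M / 2" by simp
  define l0 where "l0 = \<kappa> * M / 2 / (M powr (r - 1) + g M)"
  have den: "0 < M powr (r - 1) + g M" using M g(2)[of M] by (intro add_pos_nonneg) auto
  show ?thesis
  proof (rule that[of l0])
    show "0 < l0" using den \<kappa> M by (simp add: l0_def)
    fix l assume l: "0 < l" "l < l0"
    \<comment> \<open>Truncating the argument makes the regular part constant above \<open>M\<close> and extends it to negative arguments.\<close>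
    define cl where "cl t = min (max t 0) M" for t :: real
    have cl: "0 \<le> cl t" "cl t \<le> M" for t using M by (auto simp: cl_def)
    have cl_cont: "continuous_on UNIV cl" unfolding cl_def by (intro continuous_intros)
    have gc_cont: "continuous_on UNIV (\<lambda>t. g (cl t))"
      by (rule continuous_on_compose2[OF g(1) cl_cont]) (use cl in auto)
    define b where "b t = cl t powr (p - 1) + l * g (cl t)" for t
    have b_cont: "continuous_on UNIV b"
      unfolding b_def
      by (intro continuous_on_add continuous_on_mult continuous_on_const gc_cont continuous_on_powr' cl_cont)
         (use p cl in auto)
    have "continuous_on {0..M} g" by (rule continuous_on_subset[OF g(1)]) auto
    then have "\<exists>t\<in>{0..M}. \<forall>t'\<in>{0..M}. g t' \<le> g t"
      using M by (intro continuous_attains_sup) auto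
    then obtain tG where tG: "\<And>t. t \<in> {0..M} \<Longrightarrow> g t \<le> g tG" by blast
    have "\<exists>B. \<forall>t. - \<infinity> < ereal t \<longrightarrow> ereal t < \<infinity> \<longrightarrow> (B has_vector_derivative b t) (at t)"
      by (rule einterval_antiderivative) (use b_cont in \<open>auto simp: continuous_on_eq_continuous_at\<close>)
    then obtain B0 where B0: "\<And>t. (B0 has_real_derivative b t) (at t)"
      by (auto simp: has_real_derivative_iff_has_vector_derivative)
    define B where "B t = B0 t - B0 0" for t
    interpret singular_problem s r l M "M powr (p - 1) + l * g tG" \<kappa> b B \<Omega>
    proof
      show "0 \<le> b t" for t using l g(2)[OF cl(1)] by (simp add: b_def)
      show "b t \<le> M powr (p - 1) + l * g tG" for t
        unfolding b_def
        by (intro add_mono mult_left_mono powr_mono2 tG) (use cl l p in auto)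
      show "b t = b M" if "M \<le> t" for t using that M by (simp add: b_def cl_def)
      show "b \<in> borel_measurable borel" by (rule borel_measurable_continuous_onI[OF b_cont])
      show "(B has_real_derivative b t) (at t)" for t
        unfolding B_def using DERIV_diff[OF B0 DERIV_const] by simp
      have "l * (M powr (r - 1) + g M) \<le> \<kappa> * M / 2"
        using l(2) den by (simp add: l0_def field_simps)
      then show "l * M powr (r - 1) + b M \<le> M * \<kappa>"
        using M by (simp add: b_def cl_def Mp algebra_simps)
    qed (use s r l M \<Omega> gain in \<open>auto simp: B_def\<close>)
    obtain u where u: "u \<in> energy_space s \<Omega>" and u_bd: "\<And>x. 0 \<le> u x" "\<And>x. u x \<le> M"
      and u_pos: "AE x in lborel. x \<in> \<Omega> \<longrightarrow> 0 < u x"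
      and el: "\<And>v. v \<in> energy_space s \<Omega> \<Longrightarrow> integrable lborel (\<lambda>x. h (u x) * v x)"
        "\<And>v. v \<in> energy_space s \<Omega> \<Longrightarrow> energy s u v = (LINT x|lborel. h (u x) * v x)"
      by (rule solution_exists) blast
    note u_meas [measurable] = energy_spaceD(1)[OF u]
    have cl_u: "cl (u x) = u x" for x using u_bd[of x] by (simp add: cl_def)
    have [measurable]: "(\<lambda>x. g (u x)) \<in> borel_measurable borel"
      using measurable_compose[OF u_meas borel_measurable_continuous_onI[OF gc_cont]] by (simp add: cl_u)
    have h_u: "h (u x) = u x powr (p - 1) + l * (u x powr (r - 1) + g (u x))" for x
      by (simp add: h_def b_def cl_u algebra_simps)
    have parts: "set_integrable lebesgue \<Omega> (\<lambda>x. u x powr (r - 1) * v x) \<and>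
       gagliardo_form s u v = (LINT x:\<Omega>|lebesgue. u x powr (p - 1) * v x)
          + l * (LINT x:\<Omega>|lebesgue. (u x powr (r - 1) + g (u x)) * v x)" if v: "v \<in> X0 s \<Omega>" for v
    proof -
      obtain w where w: "w \<in> energy_space s \<Omega>" "AE x in lborel. v x = w x"
        and form: "gagliardo_form s u v = energy s u w"
        by (rule X0_representative[OF v \<Omega>_meas]) (use u_meas in blast)
      note [measurable] = energy_spaceD(1)[OF w(1)]
      have w_int: "integrable lborel w" by (rule energy_space_integrable[OF w(1) \<Omega>_meas \<Omega>_fin])
      have AE_eq: "AE x in lborel. f x * w x = indicator \<Omega> x *\<^sub>R (f x * v x)" for f :: "real ^ 'n \<Rightarrow> real"
        using w(2) by eventually_elim (use energy_spaceD(2)[OF w(1)] in \<open>auto simp: indicator_def\<close>)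
      have i1: "integrable lborel (\<lambda>x. u x powr (p - 1) * w x)"
      proof (rule Bochner_Integration.integrable_bound)
        show "integrable lborel (\<lambda>x. M powr (p - 1) * w x)" using w_int by simp
        have "u x powr (p - 1) \<le> M powr (p - 1)" for x using u_bd p by (intro powr_mono2) auto
        then show "AE x in lborel. norm (u x powr (p - 1) * w x) \<le> norm (M powr (p - 1) * w x)"
          by (intro always_eventually) (auto simp: abs_mult intro: mult_right_mono)
      qed measurable
      have i2: "integrable lborel (\<lambda>x. u x powr (r - 1) * w x)"
      proof (rule Bochner_Integration.integrable_bound)
        show "integrable lborel (\<lambda>x. 1 / l * (h (u x) * w x))" using el(1)[OF w(1)] by simp
        have "u x powr (r - 1) \<le> 1 / l * h (u x)" for x
          using l g(2)[OF u_bd(1)[of x]] by (simp add: h_u field_simps)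
        then have "\<bar>u x powr (r - 1) * w x\<bar> \<le> \<bar>1 / l * (h (u x) * w x)\<bar>" for x
          using l h_nonneg[of "u x"] mult_right_mono[of "u x powr (r - 1)" "1 / l * h (u x)" "\<bar>w x\<bar>"]
          by (simp add: abs_mult)
        then show "AE x in lborel. norm (u x powr (r - 1) * w x) \<le> norm (1 / l * (h (u x) * w x))"
          by (intro always_eventually) auto
      qed measurable
      have i3: "integrable lborel (\<lambda>x. (u x powr (r - 1) + g (u x)) * w x)"
      proof -
        have "integrable lborel (\<lambda>x. 1 / l * (h (u x) * w x - u x powr (p - 1) * w x))"
          using el(1)[OF w(1)] i1 by (intro integrable_mult_right Bochner_Integration.integrable_diff)
        moreover have "1 / l * (h (u x) * w x - u x powr (p - 1) * w x) = (u x powr (r - 1) + g (u x)) * w x" for x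
          using l by (simp add: h_u field_simps)
        ultimately show ?thesis by simp
      qed
      have "energy s u w = (LINT x|lborel. u x powr (p - 1) * w x + l * ((u x powr (r - 1) + g (u x)) * w x))"
        unfolding el(2)[OF w(1)] h_u by (simp add: algebra_simps)
      also have "\<dots> = (LINT x|lborel. u x powr (p - 1) * w x)
          + l * (LINT x|lborel. (u x powr (r - 1) + g (u x)) * w x)"
        using i1 i3 by simp
      also have "(LINT x|lborel. u x powr (p - 1) * w x) = (LINT x:\<Omega>|lebesgue. u x powr (p - 1) * v x)"
        unfolding set_lebesgue_integral_def
        by (rule lebesgue_integral_AE_transfer(2)[symmetric, OF _ AE_eq]) measurable
      also have "(LINT x|lborel. (u x powr (r - 1) + g (u x)) * w x)
          = (LINT x:\<Omega>|lebesgue. (u x powr (r - 1) + g (u x)) * v x)"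
        unfolding set_lebesgue_integral_def
        by (rule lebesgue_integral_AE_transfer(2)[symmetric, OF _ AE_eq]) measurable
      finally have "energy s u w = (LINT x:\<Omega>|lebesgue. u x powr (p - 1) * v x)
          + l * (LINT x:\<Omega>|lebesgue. (u x powr (r - 1) + g (u x)) * v x)" .
      moreover have "set_integrable lebesgue \<Omega> (\<lambda>x. u x powr (r - 1) * v x)"
        unfolding set_integrable_def
        by (rule lebesgue_integral_AE_transfer(1)[OF _ AE_eq i2]) measurable
      ultimately show ?thesis by (simp add: form)
    qed
    have "weak_solution s \<Omega> r g l u"
      unfolding weak_solution_def
    proof (intro conjI ballI)
      show "u \<in> X0 s \<Omega>" by (rule energy_space_subset_X0[OF u])
      show "AE x in lebesgue. x \<in> \<Omega> \<longrightarrow> 0 < u x" by (rule AE_completion[OF u_pos])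
    qed (use parts in \<open>auto simp: p_def\<close>)
    then show "\<exists>u. weak_solution s \<Omega> r g l u" by (intro exI)
  qed
qed

(* The case distinction on q = 1 encodes the convention 0^0 = 1 (in HOL, 0 powr 0 = 0). *)
theorem theorem2:
  fixes \<Omega> :: "(real ^ 'n) set" and s r q a1 a2 :: real and g :: "real \<Rightarrow> real"
  assumes "0 < s" "s < 1" "real CARD('n) > 2 * s"
    and "open \<Omega>" "bounded \<Omega>" "\<Omega> \<noteq> {}" "lipschitz_boundary \<Omega>"
    and "continuous_on {0..} g" "\<And>t. t \<ge> 0 \<Longrightarrow> g t \<ge> 0"
    and "a1 > 0" "a2 > 0" "1 \<le> q" "q < crit_exp CARD('n) s"
    and "\<And>t. t \<ge> 0 \<Longrightarrow> g t \<le> a1 + a2 * (if q = 1 then 1 else t powr (q - 1))"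
    and "0 < r" "r < 1"
  shows "\<exists>t0. is_arg_max (k_fun s \<Omega> r q a1 a2) (\<lambda>t. t \<ge> 0) t0 \<and>
           (\<exists>\<alpha> \<beta>. \<alpha> < \<beta> \<and> {\<alpha><..<\<beta>} \<subseteq> {0<..<k_fun s \<Omega> r q a1 a2 t0} \<and>
              (\<forall>l \<in> {\<alpha><..<\<beta>}. \<exists>u. weak_solution s \<Omega> r g l u))"
proof -
  define p where "p = crit_exp CARD('n) s"
  define c where "c = sobolev_const s \<Omega>"
  define m where "m = measure lebesgue \<Omega>"
  have p: "2 < p" using crit_exp_identities(1)[of s "CARD('n)"] assms by (simp add: p_def)
  have c: "0 < c" unfolding c_def by (rule sobolev_const_pos) (use assms in auto)
  have m: "0 < m"
  proof -
    have "emeasure lborel \<Omega> = ennreal (measure lborel \<Omega>)"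
      using emeasure_bounded_finite[OF \<open>bounded \<Omega>\<close>] by (simp add: emeasure_eq_ennreal_measure)
    with emeasure_open_pos[OF \<open>open \<Omega>\<close> \<open>\<Omega> \<noteq> {}\<close>] show ?thesis
      using \<open>open \<Omega>\<close> by (simp add: m_def)
  qed
  have k: "k_fun s \<Omega> r q a1 a2 = (\<lambda>t. (t powr (2 - r) - c powr p * t powr (p - r)) /
        (c powr r * m powr ((p - r) / p) + a1 * c * m powr ((p - 1) / p) * t powr (1 - r)
          + a2 * c powr q * m powr ((p - q) / p) * t powr (q - r)))"
    by (intro ext) (simp add: k_fun_def Let_def p_def c_def m_def)
  obtain t0 where t0: "is_arg_max (k_fun s \<Omega> r q a1 a2) (\<lambda>t. t \<ge> 0) t0" "0 < k_fun s \<Omega> r q a1 a2 t0"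
  proof -
    have "0 < c powr r * m powr ((p - r) / p)" "0 < a1 * c * m powr ((p - 1) / p)"
      "0 < c powr p" "0 < a2 * c powr q * m powr ((p - q) / p)"
      using c m \<open>0 < a1\<close> \<open>0 < a2\<close> by simp_all
    from arg_max_exists[OF \<open>0 < r\<close> \<open>r < 1\<close> p \<open>1 \<le> q\<close> this] show ?thesis
      using that unfolding k by blast
  qed
  obtain l0 where l0: "0 < l0" "\<And>l. \<lbrakk>0 < l; l < l0\<rbrakk> \<Longrightarrow> \<exists>u. weak_solution s \<Omega> r g l u"
    using weak_solution_exists[of s \<Omega> g r] assms by metis
  show ?thesis
  proof (intro exI conjI)
    show "is_arg_max (k_fun s \<Omega> r q a1 a2) (\<lambda>t. t \<ge> 0) t0" by (rule t0(1))
    show "0 < min l0 (k_fun s \<Omega> r q a1 a2 t0)" using l0(1) t0(2) by simp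
    show "{0<..<min l0 (k_fun s \<Omega> r q a1 a2 t0)} \<subseteq> {0<..<k_fun s \<Omega> r q a1 a2 t0}" by auto
    show "\<forall>l\<in>{0<..<min l0 (k_fun s \<Omega> r q a1 a2 t0)}. \<exists>u. weak_solution s \<Omega> r g l u"
      using l0(2) by auto
  qed
qed

end
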